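(* For any instance $\phi$ of (3,4)-SAT with $n$ variables and any integer $b$ with $2\le b\le n/\log_2 n$, there is an equivalent instance $(G,\beta,L)$ of Nonuniform List $(a\!:\!2b)$-Coloring such that $a=O(b^2\log b)$, $|V(G)|=O(n/\log b)$, and $G$ is 3-colorable. Moreover, the instance $(G,\beta,L)$ and a proper 3-coloring of $G$ can be constructed in time polynomial in $n$.
   Context: (3,4)-SAT is the variant of 3-SAT in which each clause contains exactly 3 different variables and each variable occurs in at most 4 clauses. Write $[a]=\{0,\dots,a-1\}$. For integers $a,b$, a graph $G$, a list function $L:V(G)\to 2^{[a]}$ and a demand function $\beta:V(G)\to\{1,\dots,b\}$, an $L$-$(a\!:\!\beta)$-coloring assigns to each vertex $v$ exactly $\beta(v)$ colors from $L(v)$ so that adjacent vertices receive disjoint color sets. Nonuniform List $(a\!:\!b)$-Coloring asks, given $(G,L,\beta)$, whether an $L$-$(a\!:\!\beta)$-coloring exists. Two instances are equivalent if both are yes-instances or both are no-instances. *)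

theory Defs
  imports Complex_Main "HOL-Computational_Algebra.Polynomial"
begin

text \<open>
  A literal is a variable together with the truth value that satisfies it. The variables of an
  instance with \<open>n\<close> variables are \<open>0, \<dots>, n - 1\<close>. A formula is a list of clauses, and occurrences
  of a variable are counted per position in that list.
\<close>

type_synonym literal = "nat \<times> bool"
type_synonym clause = "literal list"
type_synonym cnf = "clause list"

definition clause_vars :: "clause \<Rightarrow> nat set" where
  "clause_vars C = fst ` set C"

definition sat34_instance :: "nat \<Rightarrow> cnf \<Rightarrow> bool" where
  "sat34_instance n \<phi> \<longleftrightarrow>
     (\<forall>C\<in>set \<phi>. length C = 3 \<and> distinct (map fst C) \<and> clause_vars C \<subseteq> {..<n}) \<and>
     (\<forall>x<n. length (filter (\<lambda>C. x \<in> clause_vars C) \<phi>) \<le> 4)"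

definition satisfiable :: "cnf \<Rightarrow> bool" where
  "satisfiable \<phi> \<longleftrightarrow> (\<exists>\<sigma> :: nat \<Rightarrow> bool. \<forall>C\<in>set \<phi>. \<exists>(x, s)\<in>set C. \<sigma> x = s)"

record 'v graph =
  verts :: "'v set"
  edges :: "'v set set"

definition simple_graph :: "'v graph \<Rightarrow> bool" where
  "simple_graph G \<longleftrightarrow> finite (verts G) \<and> (\<forall>e\<in>edges G. e \<subseteq> verts G \<and> card e = 2)"

definition proper_coloring :: "'v graph \<Rightarrow> nat \<Rightarrow> ('v \<Rightarrow> nat) \<Rightarrow> bool" where
  "proper_coloring G k c \<longleftrightarrow>
     (\<forall>v\<in>verts G. c v < k) \<and>
     (\<forall>u\<in>verts G. \<forall>v\<in>verts G. {u, v} \<in> edges G \<longrightarrow> c u \<noteq> c v)"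

definition colorable :: "'v graph \<Rightarrow> nat \<Rightarrow> bool" where
  "colorable G k \<longleftrightarrow> (\<exists>c. proper_coloring G k c)"

definition nonuniform_instance ::
    "nat \<Rightarrow> nat \<Rightarrow> 'v graph \<Rightarrow> ('v \<Rightarrow> nat set) \<Rightarrow> ('v \<Rightarrow> nat) \<Rightarrow> bool" where
  "nonuniform_instance a b G L \<beta> \<longleftrightarrow>
     simple_graph G \<and> (\<forall>v\<in>verts G. L v \<subseteq> {..<a} \<and> \<beta> v \<in> {1..b})"

definition list_multicoloring ::
    "'v graph \<Rightarrow> ('v \<Rightarrow> nat set) \<Rightarrow> ('v \<Rightarrow> nat) \<Rightarrow> ('v \<Rightarrow> nat set) \<Rightarrow> bool" where
  "list_multicoloring G L \<beta> f \<longleftrightarrow>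
     (\<forall>v\<in>verts G. f v \<subseteq> L v \<and> card (f v) = \<beta> v) \<and>
     (\<forall>u\<in>verts G. \<forall>v\<in>verts G. {u, v} \<in> edges G \<longrightarrow> f u \<inter> f v = {})"

definition list_multicolorable ::
    "'v graph \<Rightarrow> ('v \<Rightarrow> nat set) \<Rightarrow> ('v \<Rightarrow> nat) \<Rightarrow> bool" where
  "list_multicolorable G L \<beta> \<longleftrightarrow> (\<exists>f. list_multicoloring G L \<beta> f)"

text \<open>
  Running time is measured for programs of a first-order functional language with general
  recursion, whose only data are binary trees (pure Lisp with a single atom). A program is a list
  of function bodies; the first one is the main function. Variables are de Bruijn indices into the
  environment: the body of a function sees exactly the values of its arguments, \<open>LetIn\<close> pushes one
  value, and the \<open>Node\<close> branch of a \<open>Case\<close> pushes the left and then, as index 1, the right subtree.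

  There is no built-in arithmetic or equality test, and the length of an environment is bounded by
  the size of the program. Every step is therefore a constant number of pointer operations on a
  shared heap, and this cost is polynomially related to Turing machine time.
\<close>

datatype tree = Leaf | Node tree tree

datatype expr =
    Var nat
  | MkLeaf
  | MkNode expr expr
  | LetIn expr expr
  | Case expr expr expr
  | Call nat "expr list"

type_synonym program = "expr list"

inductive eval :: "program \<Rightarrow> tree list \<Rightarrow> expr \<Rightarrow> tree \<Rightarrow> nat \<Rightarrow> bool"
  and evals :: "program \<Rightarrow> tree list \<Rightarrow> expr list \<Rightarrow> tree list \<Rightarrow> nat \<Rightarrow> bool"
  for P :: program
where
  eval_Var: "i < length \<rho> \<Longrightarrow> eval P \<rho> (Var i) (\<rho> ! i) 1"
| eval_MkLeaf: "eval P \<rho> MkLeaf Leaf 1"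
| eval_MkNode:
    "eval P \<rho> e\<^sub>1 x s \<Longrightarrow> eval P \<rho> e\<^sub>2 y t \<Longrightarrow> eval P \<rho> (MkNode e\<^sub>1 e\<^sub>2) (Node x y) (s + t + 1)"
| eval_LetIn:
    "eval P \<rho> e\<^sub>1 x s \<Longrightarrow> eval P (x # \<rho>) e\<^sub>2 y t \<Longrightarrow> eval P \<rho> (LetIn e\<^sub>1 e\<^sub>2) y (s + t + 1)"
| eval_Case_Leaf:
    "eval P \<rho> e Leaf s \<Longrightarrow> eval P \<rho> e\<^sub>1 y t \<Longrightarrow> eval P \<rho> (Case e e\<^sub>1 e\<^sub>2) y (s + t + 1)"
| eval_Case_Node:
    "eval P \<rho> e (Node l r) s \<Longrightarrow> eval P (l # r # \<rho>) e\<^sub>2 y t \<Longrightarrow>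
       eval P \<rho> (Case e e\<^sub>1 e\<^sub>2) y (s + t + 1)"
| eval_Call:
    "evals P \<rho> es xs s \<Longrightarrow> k < length P \<Longrightarrow> eval P xs (P ! k) y t \<Longrightarrow>
       eval P \<rho> (Call k es) y (s + t + 1)"
| evals_Nil: "evals P \<rho> [] [] 0"
| evals_Cons:
    "eval P \<rho> e x s \<Longrightarrow> evals P \<rho> es xs t \<Longrightarrow> evals P \<rho> (e # es) (x # xs) (s + t)"

inductive_cases eval_VarE: "eval P \<rho> (Var i) y t"
inductive_cases eval_MkLeafE: "eval P \<rho> MkLeaf y t"
inductive_cases eval_MkNodeE: "eval P \<rho> (MkNode e\<^sub>1 e\<^sub>2) y t"
inductive_cases eval_LetInE: "eval P \<rho> (LetIn e\<^sub>1 e\<^sub>2) y t"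
inductive_cases eval_CaseE: "eval P \<rho> (Case e e\<^sub>1 e\<^sub>2) y t"
inductive_cases eval_CallE: "eval P \<rho> (Call k es) y t"
inductive_cases evals_NilE: "evals P \<rho> [] ys t"
inductive_cases evals_ConsE: "evals P \<rho> (e # es) ys t"

lemma eval_deterministic:
  "eval P \<rho> e y t \<Longrightarrow> eval P \<rho> e y' t' \<Longrightarrow> y = y' \<and> t = t'"
  "evals P \<rho> es ys s \<Longrightarrow> evals P \<rho> es ys' s' \<Longrightarrow> ys = ys' \<and> s = s'"
proof (induction arbitrary: y' t' and ys' s' rule: eval_evals.inducts)
  case eval_Var then show ?case by (auto elim: eval_VarE)
next
  case eval_MkLeaf then show ?case by (auto elim: eval_MkLeafE)
next
  case eval_MkNode
  from eval_MkNode.prems show ?case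
    by (rule eval_MkNodeE) (auto dest!: eval_MkNode.IH(2,4))
next
  case eval_LetIn
  from eval_LetIn.prems show ?case
    by (rule eval_LetInE) (auto dest!: eval_LetIn.IH(2,4))
next
  case eval_Case_Leaf
  from eval_Case_Leaf.prems show ?case
    by (rule eval_CaseE) (auto dest!: eval_Case_Leaf.IH(2,4))
next
  case eval_Case_Node
  from eval_Case_Node.prems show ?case
    by (rule eval_CaseE) (auto dest!: eval_Case_Node.IH(2,4))
next
  case eval_Call
  from eval_Call.prems show ?case
    by (rule eval_CallE) (auto dest!: eval_Call.IH(2,5))
next
  case evals_Nil then show ?case by (auto elim: evals_NilE)
next
  case evals_Cons
  from evals_Cons.prems show ?case
    by (rule evals_ConsE) (auto dest!: evals_Cons.IH(2,4))
qed

text \<open>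
  Sharing can make a result larger than the number of steps that build it, so the cost of writing
  out the result is charged as well.
\<close>

definition computes :: "program \<Rightarrow> tree \<Rightarrow> tree \<Rightarrow> nat \<Rightarrow> bool" where
  "computes P x y t \<longleftrightarrow> P \<noteq> [] \<and> (\<exists>s. eval P [x] (P ! 0) y s \<and> t = s + size y)"

text \<open>
  Numbers are written in unary. For time bounds polynomial in \<open>n\<close> this is immaterial, as all
  numbers involved are bounded by a polynomial in \<open>n\<close>.
\<close>

fun enc_nat :: "nat \<Rightarrow> tree" where
  "enc_nat 0 = Leaf"
| "enc_nat (Suc n) = Node Leaf (enc_nat n)"

fun enc_bool :: "bool \<Rightarrow> tree" where
  "enc_bool False = Leaf"
| "enc_bool True = Node Leaf Leaf"

fun enc_pair :: "('a \<Rightarrow> tree) \<Rightarrow> ('b \<Rightarrow> tree) \<Rightarrow> 'a \<times> 'b \<Rightarrow> tree" where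
  "enc_pair f g (x, y) = Node (f x) (g y)"

fun enc_list :: "('a \<Rightarrow> tree) \<Rightarrow> 'a list \<Rightarrow> tree" where
  "enc_list f [] = Leaf"
| "enc_list f (x # xs) = Node (f x) (enc_list f xs)"

lemma inj_enc_nat: "inj enc_nat"
proof (rule injI)
  show "enc_nat m = enc_nat n \<Longrightarrow> m = n" for m n
    by (induction m arbitrary: n) (case_tac n; simp)+
qed

lemma inj_enc_bool: "inj enc_bool"
  by (rule injI) (metis (full_types) enc_bool.simps tree.distinct(1))

lemma inj_enc_pair: "inj f \<Longrightarrow> inj g \<Longrightarrow> inj (enc_pair f g)"
  by (rule injI) (auto dest: injD)

lemma inj_enc_list: assumes "inj f" shows "inj (enc_list f)"
proof (rule injI)
  show "enc_list f xs = enc_list f ys \<Longrightarrow> xs = ys" for xs ys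
    by (induction xs arbitrary: ys) (case_tac ys; auto dest: injD[OF assms])+
qed

definition enc_sat34 :: "nat \<Rightarrow> cnf \<Rightarrow> nat \<Rightarrow> tree" where
  "enc_sat34 n \<phi> b =
     enc_pair enc_nat (enc_pair (enc_list (enc_list (enc_pair enc_nat enc_bool))) enc_nat)
       (n, \<phi>, b)"

text \<open>
  A graph is written as its number of vertices and a list of its edges, the color lists as a list
  of lists indexed by the vertices, the demands and the vertex coloring as lists of numbers indexed
  by the vertices. The order of the edges and of the colors within a list is left open.
\<close>

definition encodes_colored_instance ::
    "tree \<Rightarrow> nat graph \<Rightarrow> (nat \<Rightarrow> nat set) \<Rightarrow> (nat \<Rightarrow> nat) \<Rightarrow> (nat \<Rightarrow> nat) \<Rightarrow> bool" where
  "encodes_colored_instance y G L \<beta> c \<longleftrightarrow>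
     (\<exists>m es Ls.
        verts G = {..<m} \<and> edges G = (\<lambda>(u, v). {u, v}) ` set es \<and>
        length Ls = m \<and> (\<forall>v<m. L v = set (Ls ! v)) \<and>
        y = enc_pair enc_nat
              (enc_pair (enc_list (enc_pair enc_nat enc_nat))
                (enc_pair (enc_list (enc_list enc_nat))
                  (enc_pair (enc_list enc_nat) (enc_list enc_nat))))
              (m, es, Ls, map \<beta> [0..<m], map c [0..<m]))"

end

theory Submission
  imports Defs "HOL-Library.More_List"
begin

text \<open>
  Colors stand for literals. A selector vertex for a group of at most \<open>b\<close> variables picks the
  colors of their false literals, and one for a group of at most \<open>b\<close> clauses picks the color of a
  true literal in each clause; both kinds are adjacent if the groups share a variable, so the picks
  are consistent. It remains to force a selector to pick exactly one color from each of its blocks,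
  which is a coin weighing problem. A neighbor whose list \<open>L\<close> consists of the blocks in a set \<open>S\<close>,
  with demand \<open>|L| - |S|\<close>, allows at most \<open>|S|\<close> picks from \<open>L\<close>; doing this for \<open>S\<close> and for its
  complement allows exactly \<open>|S|\<close>. If \<open>S\<close> ranges over a detecting family, then all blocks get exactly
  one pick, and there are detecting families with \<open>O(b / log b)\<close> sets for about \<open>b\<close> blocks.

  Variables that meet in a group or in the groups of adjacent selectors need different colors. Each
  variable has at most \<open>25 b\<^sup>2\<close> such conflicts, so a greedy coloring succeeds with \<open>O(b\<^sup>2)\<close> colors.

  The running time is bounded by closure properties: functions computable in polynomial time are
  closed under composition and under folds whose intermediate results have polynomial size.
\<close>

section \<open>Polynomial-time computable functions\<close>

text \<open>The demand of a selector fixes its total number of picks, so it only remains to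
  recognise the situation in which every block gets one. This is less than recovering an unknown
  vector: with the number of picks in a block minus 1 as weight, blocks of 2 or 3 colors give
  weights in -1, ..., 2, and a family has to detect whether all weights are 0. Such a family comes
  from the matrix J - I of order 4. Its determinant is -3, and no nonzero weight is divisible by 3,
  so four copies of a family leave room for one further element per set. Each round multiplies the
  number of sets by 4 and adds 1/4 to the ratio of elements to sets; this is the logarithmic gain.

  Selectors use groups of at most \<open>d\<close> variables or clauses, where \<open>d\<close>, the
  size of the family, is below \<open>b\<close> by at most a constant factor. The clauses of a group
  must not share a variable, or a color could lie in two blocks, so the clauses are sorted into 13
  classes before they are grouped.\<close>

primrec shift :: "nat \<Rightarrow> expr \<Rightarrow> expr" where
  "shift d (Var i) = Var i"
| "shift d MkLeaf = MkLeaf"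
| "shift d (MkNode e1 e2) = MkNode (shift d e1) (shift d e2)"
| "shift d (LetIn e1 e2) = LetIn (shift d e1) (shift d e2)"
| "shift d (Case e e1 e2) = Case (shift d e) (shift d e1) (shift d e2)"
| "shift d (Call k es) = Call (k + d) (map (shift d) es)"

lemmas eval_intros = eval_evals.intros[unfolded One_nat_def add_Suc_right add_0_right]

lemma eval_program_append:
  "eval P \<rho> e y t \<Longrightarrow> eval (P @ Q) \<rho> e y t"
  "evals P \<rho> es ys s \<Longrightarrow> evals (P @ Q) \<rho> es ys s"
  by (induction rule: eval_evals.inducts) (auto intro: eval_intros simp: nth_append)

text \<open>Code placed behind \<open>Q\<close> finds its own functions again once its call indices
  are moved by \<open>length Q\<close>. Together with \<open>eval_program_append\<close> this lets
  two programs live in one list.\<close>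

lemma eval_program_shift:
  "eval P \<rho> e y t \<Longrightarrow>
     eval (Q @ map (shift (length Q)) P) \<rho> (shift (length Q) e) y t"
  "evals P \<rho> es ys s \<Longrightarrow>
     evals (Q @ map (shift (length Q)) P) \<rho> (map (shift (length Q)) es) ys s"
  by (induction rule: eval_evals.inducts) (auto intro: eval_intros simp: nth_append)

section \<open>Encodings and their sizes\<close>

class encodable =
  fixes enc :: "'a \<Rightarrow> tree"

instantiation nat :: encodable
begin
definition enc_nat_inst: "enc = enc_nat"
instance ..
end

instantiation bool :: encodable
begin
definition enc_bool_inst: "enc = enc_bool"
instance ..
end

instantiation prod :: (encodable, encodable) encodable
begin
definition enc_prod_inst: "enc = enc_pair enc enc"
instance ..
end

instantiation list :: (encodable) encodable
begin
definition enc_list_inst: "enc = enc_list enc"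
instance ..
end

lemma enc_simps [simp]:
  "enc (0 :: nat) = Leaf"
  "enc (Suc n) = Node Leaf (enc n)"
  "enc False = Leaf"
  "enc True = Node Leaf Leaf"
  "enc (x, y) = Node (enc x) (enc y)"
  "enc ([] :: 'a :: encodable list) = Leaf"
  "enc (z # zs) = Node (enc z) (enc zs)"
  by (simp_all add: enc_nat_inst enc_bool_inst enc_prod_inst enc_list_inst)

abbreviation esize :: "'a :: encodable \<Rightarrow> nat" where
  "esize x \<equiv> size (enc x)"

lemma esize_nat [simp]: "esize (n :: nat) = n"
  by (induction n) auto

lemma esize_bool_le: "esize (b :: bool) \<le> 1"
  by (cases b) auto

lemma esize_append [simp]: "esize (xs @ ys) = esize xs + esize ys"
  by (induction xs) auto

lemma esize_rev [simp]: "esize (rev xs) = esize xs"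
  by (induction xs) auto

lemma length_le_esize: "length xs \<le> esize xs"
  by (induction xs) auto

lemma esize_member: "x \<in> set xs \<Longrightarrow> esize x \<le> esize xs"
  by (induction xs) auto

lemma esize_take_le: "esize (take k xs) \<le> esize xs"
  by (metis append_take_drop_id esize_append le_add1)

lemma esize_drop_le: "esize (drop k xs) \<le> esize xs"
  by (metis append_take_drop_id esize_append le_add2)

lemma esize_list_le:
  assumes "length xs \<le> k" "\<And>x. x \<in> set xs \<Longrightarrow> esize x \<le> c"
  shows "esize xs \<le> k * (c + 1)"
proof -
  have "esize xs \<le> length xs * (c + 1)"
    using assms(2)
  proof (induction xs)
    case (Cons a xs)
    then have "esize a \<le> c" "esize xs \<le> length xs * (c + 1)" by auto
    then show ?case by simp
  qed simp
  also have "\<dots> \<le> k * (c + 1)"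
    using assms(1) by (rule mult_right_mono) simp
  finally show ?thesis .
qed

text \<open>Natural coefficients leave no negative terms. This allows upper bounds on the argument
  to be substituted into a polynomial bound.\<close>

lemma poly_nat_mono:
  fixes p :: "nat poly"
  assumes "m \<le> n"
  shows "poly p m \<le> poly p n"
  using assms by (induction p) (auto intro!: add_mono mult_mono)

section \<open>Polynomial bounds in the size of the input\<close>

definition poly_bounded :: "('i :: encodable \<Rightarrow> nat) \<Rightarrow> bool" where
  "poly_bounded g \<longleftrightarrow> (\<exists>p. \<forall>i. g i \<le> poly p (esize i))"

named_theorems poly_bounded_intros

lemma poly_bounded_const [poly_bounded_intros]: "poly_bounded (\<lambda>i. c)"
  unfolding poly_bounded_def by (rule exI[of _ "[:c:]"]) simp

lemma poly_bounded_esize [poly_bounded_intros]: "poly_bounded esize"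
  unfolding poly_bounded_def by (rule exI[of _ "[:0, 1:]"]) simp

lemma poly_bounded_add [poly_bounded_intros]:
  assumes "poly_bounded f" "poly_bounded g"
  shows "poly_bounded (\<lambda>i. f i + g i)"
proof -
  from assms obtain p q where "\<forall>i. f i \<le> poly p (esize i)" "\<forall>i. g i \<le> poly q (esize i)"
    unfolding poly_bounded_def by blast
  then show ?thesis
    unfolding poly_bounded_def by (intro exI[of _ "p + q"]) (auto intro: add_mono)
qed

lemma poly_bounded_Suc [poly_bounded_intros]: "poly_bounded f \<Longrightarrow> poly_bounded (\<lambda>i. Suc (f i))"
  using poly_bounded_add[OF poly_bounded_const[of 1]] by simp

lemma poly_bounded_mult [poly_bounded_intros]:
  assumes "poly_bounded f" "poly_bounded g"
  shows "poly_bounded (\<lambda>i. f i * g i)"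
proof -
  from assms obtain p q where "\<forall>i. f i \<le> poly p (esize i)" "\<forall>i. g i \<le> poly q (esize i)"
    unfolding poly_bounded_def by blast
  then show ?thesis
    unfolding poly_bounded_def by (intro exI[of _ "p * q"]) (auto intro: mult_mono)
qed

lemma poly_bounded_le:
  assumes "poly_bounded g" "\<And>i. f i \<le> g i"
  shows "poly_bounded f"
  using assms unfolding poly_bounded_def by (meson order_trans)

lemma poly_bounded_poly:
  fixes p :: "nat poly"
  assumes "poly_bounded f"
  shows "poly_bounded (\<lambda>i. poly p (f i))"
proof -
  from assms obtain q where q: "\<forall>i. f i \<le> poly q (esize i)"
    unfolding poly_bounded_def by blast
  show ?thesis
    unfolding poly_bounded_def
    by (rule exI[of _ "pcompose p q"]) (simp add: poly_pcompose poly_nat_mono q)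
qed

section \<open>Functions with polynomial-time programs\<close>

definition runs ::
    "program \<Rightarrow> expr \<Rightarrow> ('a :: encodable \<Rightarrow> 'b :: encodable) \<Rightarrow> ('a \<Rightarrow> nat) \<Rightarrow> bool" where
  "runs P e f T \<longleftrightarrow> (\<forall>x. \<exists>t\<le>T x. eval P [enc x] e (enc (f x)) t)"

text \<open>The size of the result is bounded separately, since shared subtrees can make it
  exponential in the number of steps; composition relies on this bound. The entry expression is kept
  outside the program, so that programs can be merged without moving a main function.\<close>

definition ptime :: "('a :: encodable \<Rightarrow> 'b :: encodable) \<Rightarrow> bool" where
  "ptime f \<longleftrightarrow>
     poly_bounded (\<lambda>x. esize (f x)) \<and> (\<exists>P e T. poly_bounded T \<and> runs P e f T)"

lemma ptimeI:
  "runs P e f T \<Longrightarrow> poly_bounded (\<lambda>x. esize (f x)) \<Longrightarrow> poly_bounded T \<Longrightarrow> ptime f"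
  unfolding ptime_def by blast

lemma runs_append: "runs P e f T \<Longrightarrow> runs (P @ Q) e f T"
  unfolding runs_def by (meson eval_program_append)

lemma runs_shift:
  "runs P e f T \<Longrightarrow> runs (Q @ map (shift (length Q)) P) (shift (length Q) e) f T"
  unfolding runs_def by (meson eval_program_shift)

lemma poly_bounded_ptime [poly_bounded_intros]: "ptime f \<Longrightarrow> poly_bounded (\<lambda>x. esize (f x))"
  by (simp add: ptime_def)

text \<open>A program sees only trees, so values of different types with the same tree are
  interchangeable. Unary numbers and lists of \<open>False\<close> are exchanged in this
  way.\<close>

lemma ptime_enc_eq:
  assumes "ptime f" "\<And>i. enc (g i) = enc (f i)"
  shows "ptime g"
  using assms unfolding ptime_def runs_def by simp

text \<open>The first program stays in front, where its call indices remain valid; the second goes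
  behind it with shifted indices.\<close>

lemma ptime_join2:
  assumes "ptime f" "ptime g"
  obtains P e1 T1 e2 T2 where
    "runs P e1 f T1" "poly_bounded T1" "runs P e2 g T2" "poly_bounded T2"
proof -
  from assms(1) obtain P1 e1 T1 where 1: "poly_bounded T1" "runs P1 e1 f T1"
    unfolding ptime_def by blast
  from assms(2) obtain P2 e2 T2 where 2: "poly_bounded T2" "runs P2 e2 g T2"
    unfolding ptime_def by blast
  show thesis
    by (rule that[OF runs_append[OF 1(2)] 1(1) runs_shift[OF 2(2)] 2(1)])
qed

lemma ptime_join3:
  assumes "ptime f" "ptime g" "ptime h"
  obtains P e1 T1 e2 T2 e3 T3 where
    "runs P e1 f T1" "poly_bounded T1" "runs P e2 g T2" "poly_bounded T2"
    "runs P e3 h T3" "poly_bounded T3"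
proof -
  from ptime_join2[OF assms(1,2)] obtain P1 e1 T1 e2 T2 where 1:
    "runs P1 e1 f T1" "poly_bounded T1" "runs P1 e2 g T2" "poly_bounded T2" .
  from assms(3) obtain P3 e3 T3 where 3: "poly_bounded T3" "runs P3 e3 h T3"
    unfolding ptime_def by blast
  show thesis
    by (rule that[OF runs_append[OF 1(1)] 1(2) runs_append[OF 1(3)] 1(4) runs_shift[OF 3(2)] 3(1)])
qed

lemma poly_bounded_comp:
  assumes "poly_bounded g" "poly_bounded (\<lambda>x. esize (f x))"
  shows "poly_bounded (\<lambda>x. g (f x))"
proof -
  from assms(1) obtain p where "\<forall>y. g y \<le> poly p (esize y)"
    unfolding poly_bounded_def by blast
  then show ?thesis
    using poly_bounded_le[OF poly_bounded_poly[OF assms(2)]] by metis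
qed

lemma eval_Call1:
  assumes "eval P \<rho> e x s" "k < length P" "eval P [x] (P ! k) y t"
  shows "eval P \<rho> (Call k [e]) y (s + t + 1)"
  using eval_Call[OF evals_Cons[OF assms(1) evals_Nil] assms(2,3)] by simp

lemma eval_Call3:
  assumes "eval P \<rho> e1 x1 s1" "eval P \<rho> e2 x2 s2" "eval P \<rho> e3 x3 s3"
    "k < length P" "eval P [x1, x2, x3] (P ! k) y t"
  shows "eval P \<rho> (Call k [e1, e2, e3]) y (s1 + s2 + s3 + t + 1)"
  using eval_Call[OF evals_Cons[OF assms(1) evals_Cons[OF assms(2)
        evals_Cons[OF assms(3) evals_Nil]]] assms(4,5)]
  by (simp add: add.assoc)

lemma eval_Var_nth: "i < length \<rho> \<Longrightarrow> \<rho> ! i = x \<Longrightarrow> eval P \<rho> (Var i) x 1"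
  using eval_Var by blast

lemma ptime_comp:
  assumes "ptime g" "ptime f"
  shows "ptime (\<lambda>x. g (f x))"
proof -
  from ptime_join2[OF assms(2,1)] obtain P e1 T1 e2 T2 where 1:
    "runs P e1 f T1" "poly_bounded T1" "runs P e2 g T2" "poly_bounded T2" .
  \<comment> \<open>A \<open>Call\<close> rather than a \<open>LetIn\<close>: the callee then sees
    exactly \<open>[enc (f x)]\<close>, the environment for which \<open>e2\<close> was
    made.\<close>
  have "runs (P @ [e2]) (Call (length P) [e1]) (\<lambda>x. g (f x)) (\<lambda>x. T1 x + T2 (f x) + 1)"
    unfolding runs_def
  proof
    fix x
    from runs_append[OF 1(1)] obtain s
      where s: "s \<le> T1 x" "eval (P @ [e2]) [enc x] e1 (enc (f x)) s"
      unfolding runs_def by blast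
    from runs_append[OF 1(3)] obtain t
      where t: "t \<le> T2 (f x)" "eval (P @ [e2]) [enc (f x)] e2 (enc (g (f x))) t"
      unfolding runs_def by blast
    have "eval (P @ [e2]) [enc x] (Call (length P) [e1]) (enc (g (f x))) (s + t + 1)"
      by (rule eval_Call1[OF s(2)]) (use t(2) in simp_all)
    then show "\<exists>t\<le>T1 x + T2 (f x) + 1. eval (P @ [e2]) [enc x] (Call (length P) [e1]) (enc (g (f x))) t"
      using s(1) t(1) by (intro exI[of _ "s + t + 1"]) auto
  qed
  then show ?thesis
    by (rule ptimeI)
      (intro poly_bounded_intros 1 poly_bounded_comp[OF 1(4)] poly_bounded_ptime assms
        poly_bounded_comp[OF poly_bounded_ptime[OF assms(1)]])+
qed

named_theorems ptime_intros

lemma ptime_id [ptime_intros]: "ptime (\<lambda>x. x)"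
proof (rule ptimeI)
  show "runs [] (Var 0) (\<lambda>x. x) (\<lambda>x. 1)"
    unfolding runs_def using eval_Var_nth[of 0] by fastforce
qed (intro poly_bounded_intros)+

fun const_expr :: "tree \<Rightarrow> expr" where
  "const_expr Leaf = MkLeaf"
| "const_expr (Node l r) = MkNode (const_expr l) (const_expr r)"

lemma ptime_const [ptime_intros]: "ptime (\<lambda>x. c)"
proof -
  \<comment> \<open>The cost depends on the tree alone, not on the program or the environment, which
    makes the time bound a constant.\<close>
  have "\<exists>t. \<forall>P \<rho>. eval P \<rho> (const_expr y) y t" for y
    by (induction y) (auto intro: eval_intros, meson eval_intros(3))
  then obtain t where "\<forall>P \<rho>. eval P \<rho> (const_expr (enc c)) (enc c) t" by blast
  then have "runs [] (const_expr (enc c)) (\<lambda>x. c) (\<lambda>x. t)"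
    unfolding runs_def by blast
  then show ?thesis by (rule ptimeI) (intro poly_bounded_intros)+
qed

lemma ptime_node:
  fixes h :: "'a :: encodable \<Rightarrow> 'b :: encodable"
  assumes "ptime f" "ptime g" "\<And>x. enc (h x) = Node (enc (f x)) (enc (g x))"
  shows "ptime h"
proof -
  from ptime_join2[OF assms(1,2)] obtain P e1 T1 e2 T2 where 1:
    "runs P e1 f T1" "poly_bounded T1" "runs P e2 g T2" "poly_bounded T2" .
  have "runs P (MkNode e1 e2) h (\<lambda>x. T1 x + T2 x + 1)"
    unfolding runs_def
  proof
    fix x
    from 1(1,3) obtain s t where "s \<le> T1 x" "eval P [enc x] e1 (enc (f x)) s"
      "t \<le> T2 x" "eval P [enc x] e2 (enc (g x)) t"
      unfolding runs_def by blast
    then show "\<exists>t\<le>T1 x + T2 x + 1. eval P [enc x] (MkNode e1 e2) (enc (h x)) t"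
      by (intro exI[of _ "s + t + 1"]) (auto simp: assms(3) intro: eval_intros)
  qed
  moreover have "poly_bounded (\<lambda>x. esize (h x))"
    by (rule poly_bounded_le[where g = "\<lambda>x. esize (f x) + esize (g x) + 1"])
      (intro poly_bounded_intros poly_bounded_ptime assms, simp add: assms(3))
  ultimately show ?thesis
    by (rule ptimeI) (intro poly_bounded_intros 1)
qed

lemma ptime_Pair [ptime_intros]: "ptime f \<Longrightarrow> ptime g \<Longrightarrow> ptime (\<lambda>x. (f x, g x))"
  by (rule ptime_node) auto

lemma ptime_Cons [ptime_intros]: "ptime f \<Longrightarrow> ptime g \<Longrightarrow> ptime (\<lambda>x. f x # g x)"
  by (rule ptime_node) auto

lemma ptime_Suc [ptime_intros]: "ptime f \<Longrightarrow> ptime (\<lambda>x. Suc (f x))"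
  by (rule ptime_node[OF ptime_const[of False]]) auto

text \<open>Only the shape of the tree \<open>enc (u x)\<close> is inspected. One rule therefore
  serves lists, where \<open>a\<close> and \<open>b\<close> are head and tail, and truth values,
  where both subtrees are leaves.\<close>

lemma ptime_case:
  assumes "ptime u" "ptime f" "ptime g" 
    and "\<And>x. enc (u x) = Leaf \<Longrightarrow> h x = f x"
    and "\<And>x l r. enc (u x) = Node l r \<Longrightarrow> \<exists>a b. l = enc a \<and> r = enc b \<and> h x = g (x, (a, b))"
  shows "ptime h"
proof -
  from ptime_join3[OF assms(1,2,3)] obtain P e1 T1 e2 T2 e3 T3 where 1:
    "runs P e1 u T1" "poly_bounded T1" "runs P e2 f T2" "poly_bounded T2"
    "runs P e3 g T3" "poly_bounded T3" .
  from 1(6) obtain p where p: "\<And>z. T3 z \<le> poly p (esize z)"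
    unfolding poly_bounded_def by blast
  from assms(3) obtain q where q: "\<And>z. esize (g z) \<le> poly q (esize z)"
    unfolding ptime_def poly_bounded_def by blast
  define Q where "Q = P @ [e3]"
  \<comment> \<open>Below \<open>Case\<close> the environment is \<open>[l, r, enc x]\<close>, so
    the argument of the call is the encoding of \<open>(x, (a, b))\<close>. Its size is
    \<open>esize x + esize (u x) + 1\<close>.\<close>
  define e where "e = Case e1 e2 (Call (length P) [MkNode (Var 2) (MkNode (Var 0) (Var 1))])"
  have "runs Q e h (\<lambda>x. T1 x + T2 x + poly p (esize x + esize (u x) + 1) + 8)"
    unfolding runs_def
  proof
    fix x
    let ?B = "T1 x + T2 x + poly p (esize x + esize (u x) + 1) + 8"
    from 1(1,3) obtain s t where s: "s \<le> T1 x" "eval Q [enc x] e1 (enc (u x)) s"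
      and t: "t \<le> T2 x" "eval Q [enc x] e2 (enc (f x)) t"
      unfolding runs_def Q_def by (metis eval_program_append(1))
    show "\<exists>t\<le>?B. eval Q [enc x] e (enc (h x)) t"
    proof (cases "enc (u x)")
      case Leaf
      then have "eval Q [enc x] e (enc (h x)) (s + t + 1)"
        unfolding e_def using s t assms(4)[OF Leaf] by (auto intro: eval_intros)
      then show ?thesis using s(1) t(1) by (intro exI[of _ "s + t + 1"]) auto
    next
      case (Node l r)
      from assms(5)[OF this] obtain a b where ab: "l = enc a" "r = enc b" "h x = g (x, (a, b))"
        by blast
      from runs_append[OF 1(5)] obtain w where w: "w \<le> T3 (x, (a, b))"
        "eval Q [enc (x, (a, b))] e3 (enc (g (x, (a, b)))) w"
        unfolding runs_def Q_def by blast
      have "eval Q [l, r, enc x] (MkNode (Var 2) (MkNode (Var 0) (Var 1))) (enc (x, (a, b))) (1 + (1 + 1 + 1) + 1)"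
        unfolding enc_simps ab by (intro eval_MkNode eval_Var_nth) auto
      from eval_Call1[OF this, of "length P" "enc (h x)" w]
      have "eval Q [l, r, enc x] (Call (length P) [MkNode (Var 2) (MkNode (Var 0) (Var 1))]) (enc (h x)) (w + 6)"
        using w(2) ab by (simp add: Q_def eval_nat_numeral)
      from eval_Case_Node[OF s(2)[unfolded Node] this]
      have "eval Q [enc x] e (enc (h x)) (s + (w + 6) + 1)"
        unfolding e_def .
      moreover have "w \<le> poly p (esize x + esize (u x) + 1)"
        using order_trans[OF w(1) order_trans[OF p poly_nat_mono]] Node ab by simp
      ultimately show ?thesis using s(1) by (intro exI[of _ "s + (w + 6) + 1"]) auto
    qed
  qed
  moreover have "esize (h x) \<le> esize (f x) + poly q (esize x + esize (u x) + 1)" for x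
  proof (cases "enc (u x)")
    case (Node l r)
    from assms(5)[OF this] obtain a b where ab: "l = enc a" "r = enc b" "h x = g (x, (a, b))"
      by blast
    have "esize (h x) \<le> poly q (esize x + esize (u x) + 1)"
      unfolding ab(3) by (rule order_trans[OF q poly_nat_mono]) (use Node ab in simp)
    then show ?thesis by simp
  qed (simp add: assms(4))
  then have "poly_bounded (\<lambda>x. esize (h x))"
    by (rule poly_bounded_le[rotated]) (intro poly_bounded_intros poly_bounded_poly assms)
  ultimately show ?thesis
    by (rule ptimeI) (intro poly_bounded_intros 1 poly_bounded_poly assms)
qed

lemma ptime_fst' [ptime_intros]: "ptime fst" and ptime_snd' [ptime_intros]: "ptime snd"
proof -
  have "runs [] (Case (Var 0) MkLeaf (Var 0)) fst (\<lambda>x. 3)"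
    and "runs [] (Case (Var 0) MkLeaf (Var 1)) snd (\<lambda>x. 3)"
    unfolding runs_def
    by (auto intro!: exI[of _ 3] eval_Case_Node[where s = 1 and t = 1, simplified, folded numeral_3_eq_3]
        eval_Var_nth[unfolded One_nat_def])
  moreover have "poly_bounded (\<lambda>x. esize (fst x))" "poly_bounded (\<lambda>x. esize (snd x))"
    by (rule poly_bounded_le[OF poly_bounded_esize], case_tac i, simp)+
  ultimately show "ptime fst" "ptime snd"
    by (auto intro: ptimeI poly_bounded_intros)
qed

lemmas ptime_fst [ptime_intros] = ptime_comp[OF ptime_fst']
lemmas ptime_snd [ptime_intros] = ptime_comp[OF ptime_snd']

section \<open>Folds with polynomially bounded states\<close>

text \<open>Iterating a polynomial-time step may square the size of the state in every round, so a
  bound on all intermediate states has to be supplied. With it, each round costs at most a fixed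
  polynomial, and there are at most \<open>esize (xs i)\<close> rounds.\<close>

lemma ptime_foldl:
  fixes F :: "'i :: encodable \<Rightarrow> 's :: encodable \<Rightarrow> 'x :: encodable \<Rightarrow> 's"
  assumes xs: "ptime xs" and s0: "ptime s0"
    and F: "ptime (\<lambda>z. F (fst z) (snd (snd z)) (fst (snd z)))"
    and B: "poly_bounded B"
      "\<And>i k. k \<le> length (xs i) \<Longrightarrow> esize (foldl (F i) (s0 i) (take k (xs i))) \<le> B i"
  shows "ptime (\<lambda>i. foldl (F i) (s0 i) (xs i))"
proof -
  from ptime_join3[OF xs s0 F] obtain P e1 T1 e2 T2 e3 T3 where 1:
    "runs P e1 xs T1" "poly_bounded T1" "runs P e2 s0 T2" "poly_bounded T2"
    "runs P e3 (\<lambda>z. F (fst z) (snd (snd z)) (fst (snd z))) T3" "poly_bounded T3" .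
  from 1(6) obtain p where p: "\<And>z. T3 z \<le> poly p (esize z)"
    unfolding poly_bounded_def by blast
  define K where "K = length P"
  (* The loop body runs in the environment [i, xs, s]; below Case it is [x, rest, i, xs, s]. *)
  define body where "body = Case (Var 1) (Var 2)
    (Call (Suc K) [Var 2, Var 1, Call K [MkNode (Var 2) (MkNode (Var 0) (Var 4))]])"
  define Q where "Q = P @ [e3, body]"
  \<comment> \<open>The step function is called on \<open>(i, (x, s))\<close>; the 2 counts the two
    pair nodes.\<close>
  define C where "C i = poly p (esize i + esize (xs i) + B i + 2)" for i
  have Q [simp]: "Q ! K = e3" "Q ! (Suc K) = body" "K < length Q" "Suc K < length Q"
    by (auto simp: Q_def K_def nth_append)
  \<comment> \<open>A round takes 11 steps besides the evaluation of \<open>e3\<close>, and the end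
    of the list takes 3.\<close>
  have loop: "\<exists>t\<le>length ys * (C i + 11) + 3.
      eval Q [enc i, enc ys, enc s] body (enc (foldl (F i) s ys)) t"
    if "set ys \<subseteq> set (xs i)" "\<And>k. k \<le> length ys \<Longrightarrow> esize (foldl (F i) s (take k ys)) \<le> B i"
    for i s ys
    using that
  proof (induction ys arbitrary: s)
    case Nil
    have "eval Q [enc i, Leaf, enc s] body (enc s) (1 + 1 + 1)"
      unfolding body_def by (intro eval_Case_Leaf eval_Var_nth) auto
    then show ?case by (intro exI[of _ 3]) (simp add: numeral_3_eq_3)
  next
    case (Cons x ys)
    let ?z = "(i, (x, s))"
    let ?\<rho> = "[enc x, enc ys, enc i, Node (enc x) (enc ys), enc s]"
    have "esize (foldl (F i) (F i s x) (take k ys)) \<le> B i" if "k \<le> length ys" for k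
      using Cons.prems(2)[of "Suc k"] that by simp
    from Cons.IH[OF _ this] Cons.prems(1) obtain t where t: "t \<le> length ys * (C i + 11) + 3"
      "eval Q [enc i, enc ys, enc (F i s x)] body (enc (foldl (F i) (F i s x) ys)) t"
      by auto
    from runs_append[OF 1(5), of "[e3, body]"] obtain w where w: "w \<le> T3 ?z"
      "eval Q [enc ?z] e3 (enc (F i s x)) w"
      unfolding runs_def Q_def by (metis fst_conv snd_conv)
    have "esize ?z \<le> esize i + esize (xs i) + B i + 2"
      using Cons.prems(2)[of 0] esize_member[of x "xs i"] Cons.prems(1) by simp
    then have "w \<le> C i"
      unfolding C_def using order_trans[OF w(1) order_trans[OF p poly_nat_mono]] by blast
    have "eval Q ?\<rho> (MkNode (Var 2) (MkNode (Var 0) (Var 4))) (enc ?z) (1 + (1 + 1 + 1) + 1)"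
      unfolding enc_simps by (intro eval_MkNode eval_Var_nth) auto
    from eval_Call1[OF this, of K] w(2)
    have "eval Q ?\<rho> (Call K [MkNode (Var 2) (MkNode (Var 0) (Var 4))]) (enc (F i s x))
        (1 + (1 + 1 + 1) + 1 + w + 1)" by simp
    from eval_Call3[OF eval_Var_nth eval_Var_nth this, of 2 "enc i" 1 "enc ys" "Suc K"] t(2)
    have "eval Q ?\<rho> (Call (Suc K) [Var 2, Var 1, Call K [MkNode (Var 2) (MkNode (Var 0) (Var 4))]])
        (enc (foldl (F i) s (x # ys))) (1 + 1 + (1 + (1 + 1 + 1) + 1 + w + 1) + t + 1)"
      by simp
    from eval_Case_Node[OF eval_Var_nth this]
    have "eval Q [enc i, enc (x # ys), enc s] body (enc (foldl (F i) s (x # ys)))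
        (1 + (1 + 1 + (1 + (1 + 1 + 1) + 1 + w + 1) + t + 1) + 1)"
      unfolding body_def by simp
    moreover have "1 + (1 + 1 + (1 + (1 + 1 + 1) + 1 + w + 1) + t + 1) + 1
        \<le> length (x # ys) * (C i + 11) + 3"
      using t(1) \<open>w \<le> C i\<close> by simp
    ultimately show ?case by blast
  qed
  have "runs Q (Call (Suc K) [Var 0, e1, e2]) (\<lambda>i. foldl (F i) (s0 i) (xs i))
      (\<lambda>i. T1 i + T2 i + (esize (xs i) * (C i + 11) + 3) + 2)"
    unfolding runs_def
  proof
    fix i
    from 1(1,3) obtain t1 t2 where t12: "t1 \<le> T1 i" "eval Q [enc i] e1 (enc (xs i)) t1"
      "t2 \<le> T2 i" "eval Q [enc i] e2 (enc (s0 i)) t2"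
      unfolding runs_def Q_def by (metis eval_program_append(1))
    from loop[OF order_refl B(2)] obtain t where t: "t \<le> length (xs i) * (C i + 11) + 3"
      "eval Q [enc i, enc (xs i), enc (s0 i)] body (enc (foldl (F i) (s0 i) (xs i))) t"
      by blast
    note eval_Call3[OF eval_Var_nth t12(2,4), of 0 "enc i" "Suc K"]
    then have "eval Q [enc i] (Call (Suc K) [Var 0, e1, e2]) (enc (foldl (F i) (s0 i) (xs i)))
      (1 + t1 + t2 + t + 1)" using t(2) by simp
    moreover have "t \<le> esize (xs i) * (C i + 11) + 3"
      using t(1) mult_right_mono[OF length_le_esize[of "xs i"], of "C i + 11"] by linarith
    then have "1 + t1 + t2 + t + 1 \<le> T1 i + T2 i + (esize (xs i) * (C i + 11) + 3) + 2"
      using t12(1,3) by linarith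
    ultimately show "\<exists>t\<le>T1 i + T2 i + (esize (xs i) * (C i + 11) + 3) + 2.
        eval Q [enc i] (Call (Suc K) [Var 0, e1, e2]) (enc (foldl (F i) (s0 i) (xs i))) t"
      by blast
  qed
  moreover have "poly_bounded (\<lambda>i. esize (foldl (F i) (s0 i) (xs i)))"
    using B(2)[OF order_refl] by (intro poly_bounded_le[OF B(1)]) simp
  ultimately show ?thesis
    by (rule ptimeI) (unfold C_def, intro poly_bounded_intros 1 B xs poly_bounded_poly)
qed

text \<open>Makes a size bound uniform in the second argument, as \<open>map\<close> needs for the
  images of the elements of its list.\<close>

lemma ptime_bound:
  assumes "ptime (\<lambda>z. F (fst z) (snd z))" "poly_bounded b"
  obtains B where "poly_bounded B" "\<And>i x. esize x \<le> b i \<Longrightarrow> esize (F i x) \<le> B i"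
proof -
  from assms(1) obtain q where q: "\<And>z. esize (F (fst z) (snd z)) \<le> poly q (esize z)"
    unfolding ptime_def poly_bounded_def by blast
  show thesis
  proof (rule that[of "\<lambda>i. poly q (esize i + b i + 1)"])
    show "poly_bounded (\<lambda>i. poly q (esize i + b i + 1))"
      by (intro poly_bounded_intros poly_bounded_poly assms)
    show "esize (F i x) \<le> poly q (esize i + b i + 1)" if "esize x \<le> b i" for i x
      using order_trans[OF q[of "(i, x)"] poly_nat_mono] that by simp
  qed
qed

subsection \<open>Lists and numbers\<close>

lemma foldl_rev_cons: "foldl (\<lambda>s x. f x # s) ys xs = rev (map f xs) @ ys"
  by (induction xs arbitrary: ys) auto

lemma ptime_rev [ptime_intros]:
  assumes "ptime xs"
  shows "ptime (\<lambda>i. rev (xs i))"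
proof -
  have "ptime (\<lambda>i. foldl (\<lambda>s x. x # s) [] (xs i))"
    by (rule ptime_foldl[where B = "\<lambda>i. esize (xs i)"])
      ((intro ptime_intros poly_bounded_intros assms)+, simp add: foldl_rev_cons[of "\<lambda>x. x"] esize_take_le)
  then show ?thesis by (simp add: foldl_rev_cons[of "\<lambda>x. x"])
qed

lemma ptime_map [ptime_intros]:
  fixes F :: "'a :: encodable \<Rightarrow> 'b :: encodable \<Rightarrow> 'c :: encodable"
  assumes xs: "ptime xs" and F: "ptime (\<lambda>z. F (fst z) (snd z))"
  shows "ptime (\<lambda>i. map (F i) (xs i))"
proof -
  from ptime_bound[OF F poly_bounded_ptime[OF xs]] obtain B where B: "poly_bounded B"
    "\<And>i x. esize x \<le> esize (xs i) \<Longrightarrow> esize (F i x) \<le> B i" by blast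
  \<comment> \<open>The step of a fold receives \<open>(i, (x, s))\<close>, whereas \<open>F\<close>
    reads only \<open>i\<close> and \<open>x\<close>.\<close>
  have "ptime (\<lambda>z :: 'a \<times> 'b \<times> 'c list. (fst z, fst (snd z)))"
    by (intro ptime_intros)
  from ptime_comp[OF F this] have *: "ptime (\<lambda>z :: 'a \<times> 'b \<times> 'c list. F (fst z) (fst (snd z)))"
    by simp
  have "ptime (\<lambda>i. rev (foldl (\<lambda>s x. F i x # s) [] (xs i)))"
  proof (intro ptime_rev ptime_foldl[where B = "\<lambda>i. esize (xs i) * (B i + 1)"])
    show "esize (foldl (\<lambda>s x. F i x # s) [] (take k (xs i))) \<le> esize (xs i) * (B i + 1)" for i k
      unfolding foldl_rev_cons
      by (rule esize_list_le)
        (auto intro!: B(2) esize_member dest: in_set_takeD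
          simp: length_le_esize min.coboundedI1 min.coboundedI2)
  qed (intro ptime_intros poly_bounded_intros assms B *)+
  then show ?thesis by (simp add: foldl_rev_cons)
qed

lemma ptime_append [ptime_intros]:
  assumes "ptime xs" "ptime ys"
  shows "ptime (\<lambda>i. xs i @ ys i)"
proof -
  have "ptime (\<lambda>i. foldl (\<lambda>s x. x # s) (ys i) (rev (xs i)))"
  proof (rule ptime_foldl[where B = "\<lambda>i. esize (ys i) + esize (rev (xs i))"])
    show "esize (foldl (\<lambda>s x. x # s) (ys i) (take k (rev (xs i)))) \<le> esize (ys i) + esize (rev (xs i))"
      for i k
      using esize_take_le[of k "rev (xs i)"] unfolding foldl_rev_cons[of "\<lambda>x. x"] by simp
  qed (intro ptime_intros poly_bounded_intros assms)+
  then show ?thesis by (simp add: foldl_rev_cons[of "\<lambda>x. x"])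
qed

lemma esize_concat_le: "esize (concat xss) \<le> esize xss"
  by (induction xss) auto

lemma foldl_append_concat: "foldl (\<lambda>s x. s @ x) ys xss = ys @ concat xss"
  by (induction xss arbitrary: ys) auto

lemma ptime_concat [ptime_intros]:
  assumes "ptime xs"
  shows "ptime (\<lambda>i. concat (xs i))"
proof -
  have "ptime (\<lambda>i. foldl (\<lambda>s x. s @ x) [] (xs i))"
  proof (rule ptime_foldl[where B = "\<lambda>i. esize (xs i)"])
    show "esize (foldl (\<lambda>s x. s @ x) [] (take k (xs i))) \<le> esize (xs i)" for i k
      using order_trans[OF esize_concat_le esize_take_le] by (simp add: foldl_append_concat)
  qed (intro ptime_intros poly_bounded_intros assms)+
  then show ?thesis by (simp add: foldl_append_concat)
qed

lemma ptime_list_case [ptime_intros]: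
  fixes u :: "'i :: encodable \<Rightarrow> 'a :: encodable list"
  assumes "ptime u" "ptime f" "ptime (\<lambda>z. g (fst z) (fst (snd z)) (snd (snd z)))"
  shows "ptime (\<lambda>i. case u i of [] \<Rightarrow> f i | x # xs \<Rightarrow> g i x xs)"
proof (rule ptime_case[OF assms])
  show "(case u i of [] \<Rightarrow> f i | x # xs \<Rightarrow> g i x xs) = f i" if "enc (u i) = Leaf" for i
    using that by (cases "u i") auto
  show "\<exists>a b. l = enc a \<and> r = enc b \<and> (case u i of [] \<Rightarrow> f i | x # xs \<Rightarrow> g i x xs) =
      g (fst (i, a, b)) (fst (snd (i, a, b))) (snd (snd (i, a, b)))"
    if "enc (u i) = Node l r" for i l r
    using that by (cases "u i") auto
qed

lemma ptime_if [ptime_intros]: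
  assumes "ptime c" "ptime f" "ptime g"
  shows "ptime (\<lambda>i. if c i then f i else g i)"
proof (rule ptime_case[OF assms(1,3)])
  show "ptime (\<lambda>z. f (fst z))"
    by (intro ptime_comp[OF assms(2)] ptime_intros)
  show "(if c i then f i else g i) = g i" if "enc (c i) = Leaf" for i
    using that by (cases "c i") auto
  show "\<exists>a b. l = enc a \<and> r = enc b \<and> (if c i then f i else g i) = f (fst (i, a :: bool, b :: bool))"
    if "enc (c i) = Node l r" for i l r
    using that by (cases "c i") (auto intro!: exI[of _ False])
qed

lemma ptime_not [ptime_intros]: "ptime f \<Longrightarrow> ptime (\<lambda>i. \<not> f i)"
  by (rule ptime_enc_eq[OF ptime_if[OF _ ptime_const[of False] ptime_const[of True]], of f]) auto

lemma ptime_conj [ptime_intros]: "ptime f \<Longrightarrow> ptime g \<Longrightarrow> ptime (\<lambda>i. f i \<and> g i)"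
  by (rule ptime_enc_eq[OF ptime_if[OF _ _ ptime_const[of False]], of f g]) auto

lemma ptime_disj [ptime_intros]: "ptime f \<Longrightarrow> ptime g \<Longrightarrow> ptime (\<lambda>i. f i \<or> g i)"
  by (rule ptime_enc_eq[OF ptime_if[OF _ ptime_const[of True]], of f g]) auto

lemma filter_conv_concat: "filter P xs = concat (map (\<lambda>x. if P x then [x] else []) xs)"
  by (induction xs) auto

lemma ptime_filter [ptime_intros]:
  assumes "ptime xs" "ptime (\<lambda>z. F (fst z) (snd z))"
  shows "ptime (\<lambda>i. filter (F i) (xs i))"
  unfolding filter_conv_concat by (intro ptime_intros assms)

lemma ptime_bex [ptime_intros]:
  assumes xs: "ptime xs" and F: "ptime (\<lambda>z. F (fst z) (snd z))"
  shows "ptime (\<lambda>i. \<exists>x\<in>set (xs i). F i x)"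
proof -
  have "ptime (\<lambda>i. case filter (F i) (xs i) of [] \<Rightarrow> False | _ \<Rightarrow> True)"
    by (intro ptime_intros assms)
  moreover have "(case filter P ys of [] \<Rightarrow> False | _ \<Rightarrow> True) \<longleftrightarrow> (\<exists>x\<in>set ys. P x)" for P and ys :: "'b list"
    by (auto split: list.splits simp: filter_empty_conv dest: filter_eq_ConsD)
  ultimately show ?thesis by simp
qed

lemma ptime_is_Nil [ptime_intros]: "ptime xs \<Longrightarrow> ptime (\<lambda>i. xs i = [])"
  by (rule ptime_enc_eq[OF ptime_list_case[OF _ ptime_const[of True] ptime_const[of False]], of xs])
    (auto split: list.splits)

lemma ptime_tl [ptime_intros]: "ptime xs \<Longrightarrow> ptime (\<lambda>i. tl (xs i))"
  unfolding tl_def by (intro ptime_intros)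

(* A unary number n is the same tree as a list of n Leafs. *)
lemma enc_replicate_False [simp]: "enc (replicate n False) = enc n"
  by (induction n) auto

lemma ptime_replicate_False [ptime_intros]: "ptime n \<Longrightarrow> ptime (\<lambda>i. replicate (n i) False)"
  by (erule ptime_enc_eq) simp

text \<open>Erasing all entries to \<open>False\<close> turns the tree of a list into the unary
  number of its length.\<close>

lemma ptime_length [ptime_intros]:
  assumes "ptime xs"
  shows "ptime (\<lambda>i. length (xs i))"
proof (rule ptime_enc_eq)
  show "ptime (\<lambda>i. map (\<lambda>_. False) (xs i))" by (intro ptime_intros assms)
  show "enc (length (xs i)) = enc (map (\<lambda>_. False) (xs i))" for i
    by (simp add: map_replicate_const)
qed

section \<open>Arithmetic on unary numbers\<close>

lemma ptime_add [ptime_intros]: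
  assumes "ptime m" "ptime n"
  shows "ptime (\<lambda>i. m i + n i :: nat)"
proof -
  have "ptime (\<lambda>i. length (replicate (m i) False @ replicate (n i) False))"
    by (intro ptime_intros assms)
  then show ?thesis by simp
qed

lemma funpow_tl: "(tl ^^ n) xs = drop n xs"
  by (induction n arbitrary: xs) (auto simp: drop_Suc tl_drop)

lemma foldl_funpow: "foldl (\<lambda>s _. f s) s xs = (f ^^ length xs) s"
  by (induction xs arbitrary: s) (auto simp: funpow_swap1)

lemma ptime_drop [ptime_intros]:
  assumes "ptime n" "ptime xs"
  shows "ptime (\<lambda>i. drop (n i) (xs i))"
proof -
  have "ptime (\<lambda>i. foldl (\<lambda>s _. tl s) (xs i) (replicate (n i) False))"
    by (rule ptime_foldl[where B = "\<lambda>i. esize (xs i)"])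
      ((intro ptime_intros poly_bounded_intros assms)+, simp add: foldl_funpow[of tl] funpow_tl esize_drop_le)
  then show ?thesis by (simp add: foldl_funpow[of tl] funpow_tl)
qed

lemma ptime_diff [ptime_intros]:
  assumes "ptime m" "ptime n"
  shows "ptime (\<lambda>i. m i - n i :: nat)"
proof -
  have "ptime (\<lambda>i. length (drop (n i) (replicate (m i) False)))"
    by (intro ptime_intros assms)
  then show ?thesis by simp
qed

lemma ptime_take [ptime_intros]:
  assumes "ptime n" "ptime xs"
  shows "ptime (\<lambda>i. take (n i) (xs i))"
proof -
  have "ptime (\<lambda>i. rev (drop (length (xs i) - n i) (rev (xs i))))"
    by (intro ptime_intros assms)
  moreover have "rev (drop (length ys - k) (rev ys)) = take k ys" for k and ys :: "'b list"
    by (cases "k \<le> length ys") (auto simp: drop_rev)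
  ultimately show ?thesis by simp
qed

lemma ptime_le [ptime_intros]:
  assumes "ptime m" "ptime n"
  shows "ptime (\<lambda>i. (m i :: nat) \<le> n i)"
proof -
  have "ptime (\<lambda>i. replicate (m i - n i) False = [])"
    by (intro ptime_intros assms)
  then show ?thesis by simp
qed

lemma ptime_less [ptime_intros]:
  assumes "ptime m" "ptime n"
  shows "ptime (\<lambda>i. (m i :: nat) < n i)"
  unfolding less_eq_Suc_le by (intro ptime_intros assms)

lemma ptime_eq [ptime_intros]:
  assumes "ptime m" "ptime n"
  shows "ptime (\<lambda>i. (m i :: nat) = n i)"
  unfolding eq_iff by (intro ptime_intros assms)

lemma ptime_mult [ptime_intros]:
  assumes "ptime m" "ptime n"
  shows "ptime (\<lambda>i. (m i :: nat) * n i)"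
proof -
  have "ptime (\<lambda>i. length (concat (map (\<lambda>_. replicate (n i) False) (replicate (m i) False))))"
    by (intro ptime_intros ptime_comp[OF assms(2)] assms)
  then show ?thesis by (simp add: length_concat comp_def sum_list_replicate)
qed

lemma ptime_upt [ptime_intros]:
  assumes "ptime n"
  shows "ptime (\<lambda>i. [0..<n i])"
proof -
  have *: "foldl (\<lambda>s _. s @ [length s]) [] xs = [0..<length xs]" for xs :: "bool list"
    by (induction xs rule: rev_induct) auto
  have "ptime (\<lambda>i. foldl (\<lambda>s _. s @ [length s]) [] (replicate (n i) False))"
    by (rule ptime_foldl[where B = "\<lambda>i. n i * (n i + 1)"])
      ((intro ptime_intros poly_bounded_intros assms poly_bounded_ptime[OF assms, simplified])+, auto simp: * intro!: esize_list_le[simplified])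
  then show ?thesis by (simp add: *)
qed

text \<open>\<open>ptime\<close> asks for the correct result on every input, and \<open>nth\<close>
  has no specified value beyond the end of a list. The construction therefore uses
  \<open>nth_default\<close> for all lookups.\<close>

lemma ptime_nth_default [ptime_intros]:
  assumes "ptime xs" "ptime n"
  shows "ptime (\<lambda>i. nth_default d (xs i) (n i))"
proof -
  have "ptime (\<lambda>i. case drop (n i) (xs i) of [] \<Rightarrow> d | x # _ \<Rightarrow> x)"
    by (intro ptime_intros assms)
  moreover have "(case drop k ys of [] \<Rightarrow> d | x # _ \<Rightarrow> x) = nth_default d ys k" for k ys
    by (cases "k < length ys") (auto simp: nth_default_def simp flip: Cons_nth_drop_Suc)
  ultimately show ?thesis by simp
qed

section \<open>Detecting families\<close>

definition shifted :: "nat \<Rightarrow> nat \<Rightarrow> nat list \<Rightarrow> nat list" where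
  "shifted t d S = map (\<lambda>x. t * d + x) S"

text \<open>The rows of J - I of order 4, with each entry 1 replaced by a copy of \<open>S\<close>
  and the extra element added to the first row. With order 3 the extra weight would only be forced
  to be even, which leaves the value 2.\<close>

definition quad :: "nat \<Rightarrow> nat \<Rightarrow> nat list \<Rightarrow> nat list list" where
  "quad d j S =
     [shifted 1 d S @ shifted 2 d S @ shifted 3 d S @ [4 * d + j],
      shifted 0 d S @ shifted 2 d S @ shifted 3 d S,
      shifted 0 d S @ shifted 1 d S @ shifted 3 d S,
      shifted 0 d S @ shifted 1 d S @ shifted 2 d S]"

definition refine :: "nat \<times> nat list list \<Rightarrow> nat \<times> nat list list" where
  "refine s = (4 * fst s + length (snd s),
     concat (map (\<lambda>j. quad (fst s) j (nth_default [] (snd s) j)) [0..<length (snd s)]))"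

definition grow :: "nat \<Rightarrow> nat \<times> nat list list \<Rightarrow> nat \<times> nat list list" where
  "grow b s = (if 4 * fst s + length (snd s) \<le> b then refine s else s)"

text \<open>\<open>b\<close> rounds are enough, because each refining round increases the size and
  \<open>grow\<close> idles once the next family would exceed \<open>b\<close>. The fixed number of
  rounds gives the form of a fold.\<close>

definition family :: "nat \<Rightarrow> nat \<times> nat list list" where
  "family b = foldl (\<lambda>s _. grow b s) (1, [[0]]) [0..<b]"

text \<open>A trivial kernel on \<open>{-1..2}\<close>: the only vector of pick counts from 0 to 3
  that agrees with the all-ones vector on every row is the all-ones vector.\<close>

definition detecting :: "nat \<Rightarrow> nat list list \<Rightarrow> bool" where
  "detecting d rows \<longleftrightarrow>
     (\<forall>h :: nat \<Rightarrow> int. (\<forall>i<d. h i \<in> {-1..2}) \<longrightarrow> (\<forall>S\<in>set rows. sum_list (map h S) = 0) \<longrightarrow>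
        (\<forall>i<d. h i = 0))"

definition rows_below :: "nat \<Rightarrow> nat list list \<Rightarrow> bool" where
  "rows_below d rows \<longleftrightarrow> (\<forall>S\<in>set rows. distinct S \<and> set S \<subseteq> {..<d})"

lemma length_le_of_rows_below: "rows_below d rows \<Longrightarrow> S \<in> set rows \<Longrightarrow> length S \<le> d"
  unfolding rows_below_def
  by (metis card_lessThan card_mono distinct_card finite_lessThan)

lemma shifted_props:
  assumes "distinct S" "set S \<subseteq> {..<d}"
  shows "distinct (shifted t d S)" "set (shifted t d S) \<subseteq> {t * d..<Suc t * d}"
  using assms unfolding shifted_def by (auto simp: distinct_map inj_on_def)

lemma rows_below_quad:
  assumes "distinct S" "set S \<subseteq> {..<d}" "j < r"
  shows "rows_below (4 * d + r) (quad d j S)"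
proof -
  note p = shifted_props[OF assms(1,2)]
  have "set (shifted 0 d S) \<subseteq> {0..<d}" "set (shifted 1 d S) \<subseteq> {d..<2 * d}"
    "set (shifted 2 d S) \<subseteq> {2 * d..<3 * d}" "set (shifted 3 d S) \<subseteq> {3 * d..<4 * d}"
    using p(2)[of 0] p(2)[of 1] p(2)[of 2] p(2)[of 3] by auto
  then show ?thesis
    using p(1) assms(3) unfolding rows_below_def quad_def by (fastforce dest: subsetD)
qed

lemma in_set_refine:
  "T \<in> set (snd (refine (d, rows))) \<longleftrightarrow> (\<exists>j<length rows. T \<in> set (quad d j (rows ! j)))"
  by (auto simp: refine_def nth_default_def split: if_splits)

lemma rows_below_refine:
  assumes "rows_below d rows"
  shows "rows_below (fst (refine (d, rows))) (snd (refine (d, rows)))"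
  unfolding rows_below_def
proof
  fix T
  assume "T \<in> set (snd (refine (d, rows)))"
  then obtain j where "j < length rows" "T \<in> set (quad d j (rows ! j))"
    by (auto simp: in_set_refine)
  then show "distinct T \<and> set T \<subseteq> {..<fst (refine (d, rows))}"
    using assms rows_below_quad[of "rows ! j" d j "length rows"]
    by (auto simp: rows_below_def refine_def)
qed

lemma length_refine: "length (snd (refine (d, rows))) = 4 * length rows"
  by (simp add: refine_def length_concat comp_def quad_def sum_list_triv)

(* The sums s0, ..., s3 over the four copies and the weight y of the extra element satisfy
   3 * s0 = 2 * y, so 3 divides y, and y = 0 as y ranges over -1, ..., 2. *)
lemma detecting_refine:
  assumes "detecting d rows" "d \<ge> 1"
  shows "detecting (fst (refine (d, rows))) (snd (refine (d, rows)))"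
  unfolding detecting_def
proof (rule allI, rule impI, rule impI)
  fix h :: "nat \<Rightarrow> int"
  let ?r = "length rows"
  assume "\<forall>i<fst (refine (d, rows)). h i \<in> {-1..2}"
  then have h: "h i \<in> {-1..2}" if "i < 4 * d + ?r" for i
    using that by (simp add: refine_def)
  assume z: "\<forall>T\<in>set (snd (refine (d, rows))). sum_list (map h T) = 0"
  define s where "s j t = sum_list (map (\<lambda>x. h (t * d + x)) (rows ! j))" for j t
  have *: "h (4 * d + j) = 0 \<and> s j 0 = 0 \<and> s j 1 = 0 \<and> s j 2 = 0 \<and> s j 3 = 0" if "j < ?r" for j
  proof -
    have q: "\<forall>T\<in>set (quad d j (rows ! j)). sum_list (map h T) = 0"
      using z that by (auto simp: in_set_refine)
    have "s j 1 + s j 2 + s j 3 + h (4 * d + j) = 0" "s j 0 + s j 2 + s j 3 = 0"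
      "s j 0 + s j 1 + s j 3 = 0" "s j 0 + s j 1 + s j 2 = 0"
      using q by (simp_all add: quad_def shifted_def s_def comp_def add.assoc)
    moreover have "h (4 * d + j) \<in> {-1..2}"
      using h that by simp
    ultimately show ?thesis by (auto) presburger+
  qed
  have copy: "h (t * d + x) = 0" if "t < 4" "x < d" for t x
  proof -
    have "t = 0 \<or> t = 1 \<or> t = 2 \<or> t = 3" using that by auto
    then have "\<forall>S\<in>set rows. sum_list (map (\<lambda>x. h (t * d + x)) S) = 0"
      using * unfolding s_def by (auto simp: in_set_conv_nth)
    moreover have "h (t * d + x) \<in> {-1..2}" if "x < d" for x
    proof -
      have "t * d \<le> 3 * d" using \<open>t < 4\<close> by (intro mult_right_mono) auto
      then have "t * d + x < 4 * d + ?r" using that by linarith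
      then show ?thesis by (rule h)
    qed
    ultimately show ?thesis
      using assms(1)[unfolded detecting_def, rule_format, of "\<lambda>x. h (t * d + x)" x] that by blast
  qed
  show "\<forall>i<fst (refine (d, rows)). h i = 0"
  proof (intro allI impI)
    fix i
    assume i: "i < fst (refine (d, rows))"
    show "h i = 0"
    proof (cases "i < 4 * d")
      case True
      then have "i div d < 4" "i mod d < d"
        using assms(2) by (simp_all add: less_mult_imp_div_less)
      from copy[OF this] show ?thesis by simp
    next
      case False
      then show ?thesis using *[of "i - 4 * d"] i by (simp add: refine_def)
    qed
  qed
qed

section \<open>Size of the detecting family\<close>

text \<open>The recursion that sends \<open>(d, r)\<close> to \<open>(4 * d + r, 4 * r)\<close>,
  started at \<open>(1, 1)\<close>, has the solution r = 4^k, d = 4^(k-1) (k + 4); multiplying the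
  second equation by 4 keeps it in the naturals at \<open>k = 0\<close>. For \<open>b = 0\<close>
  the starting family already exceeds \<open>b\<close>, hence \<open>max 1 b\<close>.\<close>

definition good_family :: "nat \<Rightarrow> nat \<times> nat list list \<Rightarrow> bool" where
  "good_family b s \<longleftrightarrow> rows_below (fst s) (snd s) \<and> detecting (fst s) (snd s) \<and>
     1 \<le> fst s \<and> fst s \<le> max 1 b \<and>
     (\<exists>k. length (snd s) = 4 ^ k \<and> 4 * fst s = 4 ^ k * (k + 4))"

lemma good_family_init: "good_family b (1, [[0]])"
  unfolding good_family_def
  by (intro conjI exI[of _ 0]) (auto simp: rows_below_def detecting_def)

lemma good_family_grow:
  assumes "good_family b s"
  shows "good_family b (grow b s)"
proof (cases "4 * fst s + length (snd s) \<le> b")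
  case True
  obtain d rows where s: "s = (d, rows)" by (cases s)
  from assms obtain k where k: "length rows = 4 ^ k" "4 * d = 4 ^ k * (k + 4)"
    unfolding good_family_def s by auto
  have "4 * (4 * d + length rows) = 4 ^ Suc k * (Suc k + 4)"
    using k by (simp add: algebra_simps)
  then have "\<exists>k. length (snd (refine (d, rows))) = 4 ^ k \<and>
      4 * fst (refine (d, rows)) = 4 ^ k * (k + 4)"
    unfolding length_refine using k(1) by (intro exI[of _ "Suc k"]) (simp add: refine_def)
  then show ?thesis
    using assms True rows_below_refine[of d rows] detecting_refine[of d rows]
    unfolding good_family_def grow_def s by (auto simp: refine_def)
qed (use assms in \<open>simp add: grow_def\<close>)

lemma good_family_foldl: "good_family b (foldl (\<lambda>s _. grow b s) (1, [[0]]) xs)"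
  by (induction xs rule: rev_induct) (auto simp: good_family_init[simplified] good_family_grow)

lemma good_family: "good_family b (family b)"
  unfolding family_def by (rule good_family_foldl)

lemma family_maximal:
  assumes "b \<ge> 1"
  shows "b < 4 * fst (family b) + length (snd (family b))"
proof -
  \<comment> \<open>Once the next family is too large, this remains so; until then every round
    increases the size. After \<open>b\<close> rounds the second alternative contradicts the size
    bound of \<open>good_family\<close>.\<close>
  have "b < 4 * fst s + length (snd s) \<or> k < fst s"
    if "s = foldl (\<lambda>s _. grow b s) (1, [[0]]) [0..<k]" for s k
    using that
  proof (induction k arbitrary: s)
    case (Suc k)
    define s' where "s' = foldl (\<lambda>s _. grow b s) (1, [[0]]) [0..<k]"
    have "s = grow b s'" using Suc.prems by (simp add: s'_def)
    moreover have "1 \<le> fst s'"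
      using good_family_foldl unfolding s'_def good_family_def by blast
    ultimately show ?case
      using Suc.IH[OF s'_def] by (auto simp: grow_def refine_def)
  qed simp
  from this[OF family_def] show ?thesis
    using good_family[of b] assms unfolding good_family_def by fastforce
qed

text \<open>Maximality gives \<open>b < 4 ^ k * (k + 5)\<close>, which is at most
  \<open>2 ^ (3 * k + 3)\<close>. So the logarithm is below \<open>3 * (k + 4)\<close>, while
  \<open>4 ^ k * (k + 4)\<close> is 4 times the size; 12 is the product of these factors.\<close>

lemma family_ratio:
  assumes "b \<ge> 1"
  shows "real (length (snd (family b))) * log 2 (real b) \<le> 12 * real (fst (family b))"
proof -
  let ?d = "fst (family b)"
  from good_family[of b] obtain k where
    k: "length (snd (family b)) = 4 ^ k" "4 * ?d = 4 ^ k * (k + 4)"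
    unfolding good_family_def by blast
  have "k + 5 \<le> 2 ^ (k + 3)"
    by (induction k) (auto simp: power_add)
  have "b < 4 ^ k * (k + 5)"
    using family_maximal[OF assms] k by (simp add: algebra_simps)
  also have "\<dots> \<le> 4 ^ k * 2 ^ (k + 3)"
    using \<open>k + 5 \<le> 2 ^ (k + 3)\<close> by (rule mult_left_mono) simp
  also have "\<dots> = 2 ^ (3 * k + 3)"
    by (simp add: power_add power_mult flip: power_mult_distrib)
  finally have "real b \<le> 2 ^ (3 * k + 3)"
    by (metis less_imp_le of_nat_le_iff of_nat_numeral of_nat_power)
  then have "log 2 (real b) \<le> log 2 (2 ^ (3 * k + 3))"
    using assms by (subst log_le_cancel_iff) auto
  also have "\<dots> = real (3 * k + 3)"
    by (subst log_pow_cancel) auto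
  finally have "real (4 ^ k) * log 2 (real b) \<le> real (4 ^ k) * real (3 * k + 3)"
    by (intro mult_left_mono) auto
  also have "\<dots> \<le> 3 * real (4 ^ k * (k + 4))"
    by simp
  also have "\<dots> = 12 * real ?d"
    unfolding k(2)[symmetric] by simp
  finally show ?thesis using k(1) by simp
qed

section \<open>Greedy colorings and chunks\<close>

text \<open>By the pigeonhole principle a value missing from \<open>U\<close> exists below
  \<open>Suc (length U)\<close>. A bounded search over lists is covered by the closure rules for
  \<open>ptime\<close>.\<close>

definition mex :: "nat list \<Rightarrow> nat" where
  "mex U = nth_default 0 (filter (\<lambda>c. \<not> (\<exists>u\<in>set U. c = u)) [0..<Suc (length U)]) 0"

lemma filter_upt_least:
  assumes "\<exists>m<n. P m"
  shows "nth_default 0 (filter P [0..<n]) 0 = (LEAST m. P m)"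
proof -
  define m where "m = (LEAST m. P m)"
  have m: "P m" "\<And>k. k < m \<Longrightarrow> \<not> P k" "m < n"
    using assms unfolding m_def by (auto intro: LeastI dest: not_less_Least Least_le elim: le_less_trans)
  have "[0..<n] = [0..<m] @ m # [Suc m..<n]"
    using m(3) upt_add_eq_append[of 0 m "n - m"] upt_conv_Cons[of m n] by simp
  then have "filter P [0..<n] = m # filter P [Suc m..<n]"
    using m by (simp add: filter_empty_conv)
  then show ?thesis by (simp add: m_def)
qed

lemma mex:
  shows mex_notin: "mex U \<notin> set U" and mex_le_card: "mex U \<le> card (set U)"
proof -
  have "\<exists>m<Suc (length U). m \<notin> set U"
  proof (rule ccontr)
    assume "\<not> ?thesis"
    then have "{..<Suc (length U)} \<subseteq> set U" by auto
    then have "Suc (length U) \<le> card (set U)"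
      by (metis card_lessThan card_mono finite_set)
    then show False using card_length[of U] by simp
  qed
  then have "mex U = (LEAST m. m \<notin> set U)" and ex: "\<exists>m. m \<notin> set U"
    unfolding mex_def using filter_upt_least[of "Suc (length U)" "\<lambda>m. m \<notin> set U"] by auto
  then show "mex U \<notin> set U"
    using LeastI_ex[OF ex] by simp
  have "{..<mex U} \<subseteq> set U"
    unfolding \<open>mex U = _\<close> using not_less_Least by blast
  then show "mex U \<le> card (set U)"
    by (metis card_lessThan card_mono finite_set)
qed

definition greedy :: "(nat \<Rightarrow> nat \<Rightarrow> bool) \<Rightarrow> nat \<Rightarrow> nat list" where
  "greedy adj n =
     foldl (\<lambda>cs v. cs @ [mex (map (nth_default 0 cs) (filter (adj v) [0..<length cs]))]) [] [0..<n]"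

lemma greedy_0: "greedy adj 0 = []"
  by (simp add: greedy_def)

lemma greedy_Suc:
  "greedy adj (Suc n) = greedy adj n @
     [mex (map (nth_default 0 (greedy adj n)) (filter (adj n) [0..<length (greedy adj n)]))]"
  by (simp add: greedy_def)

lemma length_greedy [simp]: "length (greedy adj n) = n"
  by (induction n) (auto simp: greedy_0 greedy_Suc)

lemma greedy_nth: "v < n \<Longrightarrow> greedy adj n ! v = greedy adj (Suc v) ! v"
  by (induction n) (auto simp: greedy_Suc nth_append less_Suc_eq)

lemma greedy_nth_eq:
  assumes "v < n"
  shows "greedy adj n ! v = mex (map ((!) (greedy adj n)) (filter (adj v) [0..<v]))"
proof -
  have "map (nth_default 0 (greedy adj v)) (filter (adj v) [0..<v]) =
      map ((!) (greedy adj n)) (filter (adj v) [0..<v])"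
  proof (rule map_cong[OF refl])
    fix u assume "u \<in> set (filter (adj v) [0..<v])"
    then have "u < v" by auto
    then show "nth_default 0 (greedy adj v) u = greedy adj n ! u"
      using assms greedy_nth[of u v adj] greedy_nth[of u n adj] by (simp add: nth_default_def)
  qed
  then show ?thesis
    unfolding greedy_nth[OF assms] greedy_Suc by (simp only: nth_append length_greedy) simp
qed

lemma greedy_proper:
  assumes "u < v" "v < n" "adj v u"
  shows "greedy adj n ! v \<noteq> greedy adj n ! u"
proof -
  have "greedy adj n ! u \<in> set (map ((!) (greedy adj n)) (filter (adj v) [0..<v]))"
    using assms by auto
  moreover have "greedy adj n ! v \<notin> set (map ((!) (greedy adj n)) (filter (adj v) [0..<v]))"
    by (subst greedy_nth_eq[OF assms(2)]) (rule mex_notin)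
  ultimately show ?thesis by metis
qed

lemma greedy_le_card:
  assumes "v < n"
  shows "greedy adj n ! v \<le> card {u. u < v \<and> adj v u}"
proof -
  let ?A = "{u. u < v \<and> adj v u}"
  let ?U = "map ((!) (greedy adj n)) (filter (adj v) [0..<v])"
  have "greedy adj n ! v \<le> card (set ?U)"
    unfolding greedy_nth_eq[OF assms] by (rule mex_le_card)
  also have "set ?U = (!) (greedy adj n) ` ?A"
    by auto
  also have "card \<dots> \<le> card ?A"
    by (rule card_image_le) simp
  finally show ?thesis .
qed

section \<open>Cutting a list into pieces\<close>

text \<open>For \<open>d \<ge> 1\<close> the offsets \<open>j * d\<close> with
  \<open>j < length xs\<close> cover the whole list; the empty pieces beyond its end are removed.
  This avoids a division.\<close>

definition chunks :: "nat \<Rightarrow> 'a list \<Rightarrow> 'a list list" where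
  "chunks d xs = filter (\<lambda>ys. ys \<noteq> []) (map (\<lambda>j. take d (drop (j * d) xs)) [0..<length xs])"

lemma concat_filter_nonempty: "concat (filter (\<lambda>ys. ys \<noteq> []) xss) = concat xss"
  by (induction xss) auto

lemma concat_map_take_drop: "concat (map (\<lambda>j. take d (drop (j * d) xs)) [0..<m]) = take (m * d) xs"
proof (induction m)
  case (Suc m)
  then show ?case using take_add[of "m * d" d xs] by (simp add: add.commute)
qed simp

lemma concat_chunks:
  assumes "d \<ge> 1"
  shows "concat (chunks d xs) = xs"
  using assms unfolding chunks_def concat_filter_nonempty concat_map_take_drop by simp

lemma in_set_chunks:
  assumes "ys \<in> set (chunks d xs)"
  shows "ys \<noteq> []" "length ys \<le> d"
  using assms by (auto simp: chunks_def)

lemma length_chunks_le: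
  assumes "d \<ge> 1"
  shows "length (chunks d xs) \<le> length xs div d + 1"
proof -
  have "length (chunks d xs) =
      card {j. j < length xs \<and> take d (drop (j * d) xs) \<noteq> []}"
    unfolding chunks_def by (simp add: filter_map comp_def length_filter_conv_card cong: conj_cong)
  also have "\<dots> \<le> card {..length xs div d}"
  proof (rule card_mono)
    show "{j. j < length xs \<and> take d (drop (j * d) xs) \<noteq> []} \<subseteq> {..length xs div d}"
    proof
      fix j assume "j \<in> {j. j < length xs \<and> take d (drop (j * d) xs) \<noteq> []}"
      then have "j * d \<le> length xs" by auto
      then show "j \<in> {..length xs div d}"
        using assms by (simp add: less_eq_div_iff_mult_less_eq)
    qed
  qed simp
  finally show ?thesis by simp
qed

lemma set_chunks: "d \<ge> 1 \<Longrightarrow> (\<Union>ys\<in>set (chunks d xs). set ys) = set xs"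
  using arg_cong[OF concat_chunks[of d xs], of set] by simp

lemma distinct_chunks:
  assumes "d \<ge> 1" "distinct xs"
  shows distinct_chunk: "ys \<in> set (chunks d xs) \<Longrightarrow> distinct ys"
    and chunk_unique: "ys \<in> set (chunks d xs) \<Longrightarrow> zs \<in> set (chunks d xs) \<Longrightarrow>
      x \<in> set ys \<Longrightarrow> x \<in> set zs \<Longrightarrow> ys = zs"
proof -
  have "distinct (concat (chunks d xs))"
    using assms by (simp add: concat_chunks)
  then show "ys \<in> set (chunks d xs) \<Longrightarrow> distinct ys"
    and "ys \<in> set (chunks d xs) \<Longrightarrow> zs \<in> set (chunks d xs) \<Longrightarrow>
      x \<in> set ys \<Longrightarrow> x \<in> set zs \<Longrightarrow> ys = zs"
    unfolding distinct_concat_iff by blast+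
qed

section \<open>Selector gadgets\<close>

text \<open>Kind 0 stands for variables, kind 1 for clauses, and vertices have kind 2 if they are
  testers. The kind of a vertex is also its color in the 3-coloring. A vertex carries its list,
  demand and variables, so that the graph can be read off the list of vertices.\<close>

type_synonym group = "nat \<times> nat list \<times> nat list list"
type_synonym vertex = "nat \<times> nat \<times> nat list \<times> nat \<times> nat list"

abbreviation kind :: "group \<Rightarrow> nat" where "kind G \<equiv> fst G"
abbreviation vars :: "group \<Rightarrow> nat list" where "vars G \<equiv> fst (snd G)"
abbreviation blocks :: "group \<Rightarrow> nat list list" where "blocks G \<equiv> snd (snd G)"

abbreviation vgroup :: "vertex \<Rightarrow> nat" where "vgroup v \<equiv> fst v"
abbreviation vkind :: "vertex \<Rightarrow> nat" where "vkind v \<equiv> fst (snd v)"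
abbreviation vlist :: "vertex \<Rightarrow> nat list" where "vlist v \<equiv> fst (snd (snd v))"
abbreviation vdemand :: "vertex \<Rightarrow> nat" where "vdemand v \<equiv> fst (snd (snd (snd v)))"
abbreviation vvars :: "vertex \<Rightarrow> nat list" where "vvars v \<equiv> snd (snd (snd (snd v)))"

definition tests :: "nat list list \<Rightarrow> nat \<Rightarrow> nat list list" where
  "tests rows m =
     (let R = map (filter (\<lambda>i. i < m)) rows
      in filter (\<lambda>S. \<not> S = []) (R @ map (\<lambda>S. filter (\<lambda>i. \<not> i \<in> set S) [0..<m]) R))"

definition block_union :: "nat list list \<Rightarrow> nat list \<Rightarrow> nat list" where
  "block_union B S = concat (map (nth_default [] B) S)"

definition selector :: "nat \<Rightarrow> group \<Rightarrow> vertex" where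
  "selector g G = (g, kind G, concat (blocks G), length (blocks G), vars G)"

definition tester :: "nat \<Rightarrow> nat list list \<Rightarrow> nat list \<Rightarrow> vertex" where
  "tester g B S = (g, 2, block_union B S, length (block_union B S) - length S, [])"

definition gadget :: "nat list list \<Rightarrow> nat \<Rightarrow> group \<Rightarrow> vertex list" where
  "gadget rows g G =
     selector g G # map (tester g (blocks G)) (tests rows (length (blocks G)))"

definition vertices :: "nat list list \<Rightarrow> group list \<Rightarrow> vertex list" where
  "vertices rows GS =
     concat (map (\<lambda>g. gadget rows g (nth_default (0, [], []) GS g)) [0..<length GS])"

text \<open>The second case records one orientation only; \<open>gadget_graph\<close> turns the
  pairs into unordered edges.\<close>

definition adjacent :: "vertex \<Rightarrow> vertex \<Rightarrow> bool" where
  "adjacent v w \<longleftrightarrow> vgroup v = vgroup w \<and> \<not> vkind v = vkind w \<or>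
     vkind v = 0 \<and> vkind w = 1 \<and> (\<exists>x\<in>set (vvars v). x \<in> set (vvars w))"

definition vertex_at :: "vertex list \<Rightarrow> nat \<Rightarrow> vertex" where
  "vertex_at W = nth_default (0, 0, [], 0, []) W"

definition edge_list :: "vertex list \<Rightarrow> (nat \<times> nat) list" where
  "edge_list W = concat (map (\<lambda>p. map (\<lambda>q. (p, q))
     (filter (\<lambda>q. adjacent (vertex_at W p) (vertex_at W q)) [0..<length W])) [0..<length W])"

definition gadget_graph :: "vertex list \<Rightarrow> nat graph" where
  "gadget_graph W = \<lparr>verts = {..<length W}, edges = (\<lambda>(u, v). {u, v}) ` set (edge_list W)\<rparr>"

definition transversal :: "nat set \<Rightarrow> nat list list \<Rightarrow> bool" where
  "transversal X B \<longleftrightarrow> X \<subseteq> set (concat B) \<and> (\<forall>b\<in>set B. card (X \<inter> set b) = 1)"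

text \<open>Length at least 2 makes the demands of testers positive. Length at most 3 bounds these
  demands by \<open>2 * d\<close> and keeps the weights in \<open>{-1..2}\<close>.\<close>

definition block_system :: "nat \<Rightarrow> nat list list \<Rightarrow> bool" where
  "block_system d B \<longleftrightarrow>
     distinct (concat B) \<and> (\<forall>b\<in>set B. 2 \<le> length b \<and> length b \<le> 3) \<and> length B \<le> d"

section \<open>Counting picks in unions of disjoint blocks\<close>

lemma set_block_union: "set (block_union B S) = (\<Union>i\<in>set S. set (nth_default [] B i))"
  by (simp add: block_union_def)

lemma blocks_disjoint:
  assumes "distinct (concat B)" "i < length B" "j < length B" "i \<noteq> j"
  shows "set (B ! i) \<inter> set (B ! j) = {}"
  using assms
proof (induction B arbitrary: i j)
  case (Cons b B)
  have *: "set b \<inter> set (B ! k) = {}" if "k < length B" for k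
    using Cons.prems(1) nth_mem[OF that] by auto
  show ?case
    using Cons.prems Cons.IH * by (cases i; cases j) (auto simp: Int_commute)
qed simp

lemma block_union_inter_card:
  assumes "distinct (concat B)" "distinct S" "set S \<subseteq> {..<length B}"
  shows "card (X \<inter> set (block_union B S)) = sum_list (map (\<lambda>i. card (X \<inter> set (B ! i))) S)"
  using assms(2,3)
proof (induction S)
  case (Cons i S)
  have eq: "block_union B (i # S) = B ! i @ block_union B S"
    using Cons.prems by (simp add: block_union_def nth_default_def)
  have "set (B ! i) \<inter> set (block_union B S) = {}"
  proof -
    have "set (B ! i) \<inter> set (nth_default [] B j) = {}" if "j \<in> set S" for j
      using blocks_disjoint[OF assms(1), of i j] Cons.prems that by (auto simp: nth_default_def)
    then show ?thesis by (auto simp: set_block_union)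
  qed
  then have "card (X \<inter> set (block_union B (i # S))) =
      card (X \<inter> set (B ! i)) + card (X \<inter> set (block_union B S))"
    unfolding eq set_append Int_Un_distrib by (intro card_Un_disjoint) auto
  then show ?case using Cons by simp
qed (simp add: block_union_def)

text \<open>Counting with \<open>X = UNIV\<close> in \<open>block_union_inter_card\<close>: the set
  of entries has as many elements as the list has positions.\<close>

lemma distinct_block_union:
  assumes "distinct (concat B)" "distinct S" "set S \<subseteq> {..<length B}"
  shows "distinct (block_union B S)"
proof -
  have "card (UNIV \<inter> set (block_union B S)) = sum_list (map (\<lambda>i. card (UNIV \<inter> set (B ! i))) S)"
    by (rule block_union_inter_card[OF assms])
  also have "map (\<lambda>i. card (UNIV \<inter> set (B ! i))) S = map length (map (nth_default [] B) S)"
  proof -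
    have "card (set (B ! i)) = length (nth_default [] B i)" if "i \<in> set S" for i
    proof -
      have i: "i < length B" using assms(3) that by auto
      then have "distinct (B ! i)" using assms(1) unfolding distinct_concat_iff by simp
      then show ?thesis using i by (simp add: nth_default_def distinct_card)
    qed
    then show ?thesis by simp
  qed
  also have "sum_list \<dots> = length (block_union B S)"
    unfolding block_union_def length_concat ..
  finally show ?thesis by (simp add: card_distinct)
qed

lemma block_union_upt: "block_union B [0..<length B] = concat B"
proof -
  have "map (nth_default [] B) [0..<length B] = B"
    by (rule nth_equalityI) (auto simp: nth_default_def)
  then show ?thesis by (simp add: block_union_def)
qed

lemma transversal_card_union:
  assumes "distinct (concat B)" "transversal X B" "distinct S" "set S \<subseteq> {..<length B}"
  shows "card (X \<inter> set (block_union B S)) = length S"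
proof -
  have "map (\<lambda>i. card (X \<inter> set (B ! i))) S = map (\<lambda>_. 1) S"
    using assms(2,4) unfolding transversal_def by (auto intro!: map_cong)
  then show ?thesis
    unfolding block_union_inter_card[OF assms(1,3,4)] by (simp only: sum_list_triv) simp
qed

lemma transversal_card:
  assumes "distinct (concat B)" "transversal X B"
  shows "card X = length B"
proof -
  have "X \<inter> set (concat B) = X"
    using assms(2) by (auto simp: transversal_def)
  then show ?thesis
    using transversal_card_union[OF assms, of "[0..<length B]"] by (simp add: block_union_upt atLeast0LessThan)
qed

lemma in_tests:
  assumes "rows_below d rows" "S \<in> set (tests rows m)"
  shows "distinct S" "set S \<subseteq> {..<m}" "S \<noteq> []"
  using assms by (auto simp: tests_def rows_below_def Let_def)

lemma length_block_union_ge: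
  assumes "block_system d B" "set S \<subseteq> {..<length B}"
  shows "2 * length S \<le> length (block_union B S)" "length (block_union B S) \<le> 3 * length S"
proof -
  have "2 * length S \<le> length (block_union B S) \<and> length (block_union B S) \<le> 3 * length S"
    using assms(2)
  proof (induction S)
    case (Cons i S)
    then have "2 \<le> length (B ! i)" "length (B ! i) \<le> 3"
      using assms(1) by (auto simp: block_system_def)
    then show ?case using Cons by (auto simp: block_union_def nth_default_def)
  qed (simp add: block_union_def)
  then show "2 * length S \<le> length (block_union B S)" "length (block_union B S) \<le> 3 * length S"
    by auto
qed

lemma sum_list_split_filter:
  fixes c :: "nat \<Rightarrow> nat"
  assumes "distinct S" "set S \<subseteq> {..<m}"
  shows "sum_list (map c S) + sum_list (map c (filter (\<lambda>i. \<not> i \<in> set S) [0..<m])) =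
    sum_list (map c [0..<m])"
proof -
  have "sum c (set S) + sum c ({..<m} - set S) = sum c {..<m}"
    using sum.subset_diff[OF assms(2), of c] by simp
  moreover have "set (filter (\<lambda>i. \<not> i \<in> set S) [0..<m]) = {..<m} - set S" by auto
  ultimately show ?thesis
    using assms(1) by (simp add: sum_list_distinct_conv_sum_set atLeast0LessThan)
qed

lemma sum_list_Suc_nat: "int (sum_list (map c S)) - int (length S) = sum_list (map (\<lambda>i. int (c i) - 1) S)"
  by (induction S) auto

lemma sum_list_filter_zero:
  fixes h :: "nat \<Rightarrow> int"
  shows "sum_list (map (\<lambda>i. if P i then h i else 0) S) = sum_list (map h (filter P S))"
  by (induction S) auto

text \<open>The counts on a cut row and on its complement add up to \<open>length B\<close>, as do
  their lengths. Two upper bounds that are tight in total are tight separately, so all row sums of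
  the weights vanish and the family detects that the weights are 0.\<close>

lemma transversalI_tests:
  assumes rows: "rows_below d rows" "detecting d rows" and B: "block_system d B"
    and X: "X \<subseteq> set (concat B)" "card X = length B"
    and le: "\<And>S. S \<in> set (tests rows (length B)) \<Longrightarrow> card (X \<inter> set (block_union B S)) \<le> length S"
  shows "transversal X B"
proof -
  let ?m = "length B"
  define c where "c i = card (X \<inter> set (B ! i))" for i
  \<comment> \<open>Weight 0 beyond the last block makes the sum over a full row equal to the sum
    over the cut row.\<close>
  define h where "h i = (if i < ?m then int (c i) - 1 else 0)" for i
  have dist: "distinct (concat B)" using B by (simp add: block_system_def)
  \<comment> \<open>The empty sets, removed from \<open>tests\<close>, satisfy the bound
    trivially.\<close>
  have le': "sum_list (map c S) \<le> length S"
    if "S \<in> set (tests rows ?m) \<or> S = []" for S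
    using that le[of S] block_union_inter_card[OF dist, of S X] in_tests[OF rows(1), of S ?m]
    unfolding c_def by auto
  have total: "sum_list (map c [0..<?m]) = ?m"
    using block_union_inter_card[OF dist, of "[0..<?m]" X] X
    unfolding c_def by (simp add: block_union_upt atLeast0LessThan Int_absorb2)
  have "sum_list (map h S) = 0" if "S \<in> set rows" for S
  proof -
    let ?S = "filter (\<lambda>i. i < ?m) S" and ?S' = "filter (\<lambda>i. \<not> i \<in> set (filter (\<lambda>i. i < ?m) S)) [0..<?m]"
    have S: "distinct ?S" "set ?S \<subseteq> {..<?m}"
      using rows(1) that by (auto simp: rows_below_def)
    have "?S \<in> set (tests rows ?m) \<or> ?S = []" "?S' \<in> set (tests rows ?m) \<or> ?S' = []"
      using that by (auto simp: tests_def Let_def)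
    from le'[OF this(1)] le'[OF this(2)]
    have "sum_list (map c ?S) \<le> length ?S" "sum_list (map c ?S') \<le> length ?S'" .
    moreover have "sum_list (map c ?S) + sum_list (map c ?S') = ?m"
      using sum_list_split_filter[OF S, of c] total by simp
    moreover have "length ?S + length ?S' = ?m"
      using sum_list_split_filter[OF S, of "\<lambda>_. 1"] by (simp add: sum_list_triv)
    ultimately have "int (sum_list (map c ?S)) - int (length ?S) = 0" by linarith
    then show ?thesis
      unfolding h_def sum_list_filter_zero sum_list_Suc_nat .
  qed
  moreover have "h i \<in> {-1..2}" for i
  proof -
    have "c i \<le> 3" if "i < ?m"
    proof -
      have "c i \<le> card (set (B ! i))"
        unfolding c_def by (rule card_mono) auto
      also have "\<dots> \<le> length (B ! i)" by (rule card_length)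
      also have "\<dots> \<le> 3" using B that by (auto simp: block_system_def)
      finally show ?thesis .
    qed
    then show ?thesis by (auto simp: h_def)
  qed
  ultimately have "h i = 0" if "i < d" for i
    using rows(2) that unfolding detecting_def by blast
  then have "c i = 1" if "i < ?m" for i
    using that B unfolding h_def block_system_def by (metis eq_iff_diff_eq_0 less_le_trans of_nat_1_eq_iff)
  then show ?thesis
    using X(1) unfolding transversal_def c_def by (auto simp: in_set_conv_nth)
qed

section \<open>The gadget graph and its 3-coloring\<close>

lemma in_set_vertices:
  "v \<in> set (vertices rows GS) \<longleftrightarrow>
     (\<exists>g<length GS. v = selector g (GS ! g) \<or>
        (\<exists>S\<in>set (tests rows (length (blocks (GS ! g)))). v = tester g (blocks (GS ! g)) S))"
  by (auto simp: vertices_def gadget_def nth_default_def)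

lemma vertex_at_nth: "p < length W \<Longrightarrow> vertex_at W p = W ! p"
  by (simp add: vertex_at_def nth_default_def)

lemma in_edges_gadget_graph:
  "e \<in> edges (gadget_graph W) \<longleftrightarrow>
     (\<exists>p q. p < length W \<and> q < length W \<and> adjacent (W ! p) (W ! q) \<and> e = {p, q})"
proof -
  have "set (edge_list W) = {(p, q). p < length W \<and> q < length W \<and> adjacent (W ! p) (W ! q)}"
    by (auto simp: edge_list_def vertex_at_nth)
  then show ?thesis unfolding gadget_graph_def by auto
qed

lemma gadget_graph_edge:
  "{p, q} \<in> edges (gadget_graph W) \<longleftrightarrow> p < length W \<and> q < length W \<and>
     (adjacent (W ! p) (W ! q) \<or> adjacent (W ! q) (W ! p))"
  unfolding in_edges_gadget_graph doubleton_eq_iff by blast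

lemma verts_gadget_graph [simp]: "verts (gadget_graph W) = {..<length W}"
  by (simp add: gadget_graph_def)

lemma simple_gadget_graph: "simple_graph (gadget_graph W)"
  unfolding simple_graph_def Ball_def in_edges_gadget_graph
  by (auto simp: adjacent_def card_insert_if)

text \<open>Both cases of \<open>adjacent\<close> join vertices of different kinds.\<close>

lemma gadget_graph_coloring:
  assumes "\<forall>v\<in>set W. vkind v < 3"
  shows "proper_coloring (gadget_graph W) 3 (\<lambda>p. vkind (vertex_at W p))"
  using assms unfolding proper_coloring_def
  by (auto simp: gadget_graph_edge vertex_at_nth adjacent_def)

section \<open>Colorings and choices of transversals\<close>

text \<open>The problem without its testers, halfway between formulas and colorings. Equal groups
  may share their transversal, because the conditions depend on the group and not on its position;
  hence \<open>U\<close> takes groups instead of indices.\<close>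

definition group_solution :: "group list \<Rightarrow> (group \<Rightarrow> nat set) \<Rightarrow> bool" where
  "group_solution GS U \<longleftrightarrow>
     (\<forall>G\<in>set GS. transversal (U G) (blocks G)) \<and>
     (\<forall>G\<in>set GS. \<forall>H\<in>set GS. kind G = 0 \<longrightarrow> kind H = 1 \<longrightarrow> set (vars G) \<inter> set (vars H) \<noteq> {} \<longrightarrow>
        U G \<inter> U H = {})"

definition group_instance :: "nat \<Rightarrow> group list \<Rightarrow> bool" where
  "group_instance d GS \<longleftrightarrow>
     (\<forall>G\<in>set GS. kind G < 2 \<and> block_system d (blocks G) \<and> blocks G \<noteq> [])"

lemma multicolorable_if_group_solution:
  assumes rows: "rows_below d rows" and GS: "group_instance d GS" and U: "group_solution GS U"
    and W: "W = vertices rows GS"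
  shows "list_multicolorable (gadget_graph W)
    (\<lambda>p. set (vlist (vertex_at W p))) (\<lambda>p. vdemand (vertex_at W p))"
proof -
  \<comment> \<open>A tester takes what the transversal of its group leaves of its list. A
    transversal meets the union of the blocks in \<open>S\<close> in \<open>length S\<close> colors,
    so the demand is met exactly.\<close>
  define F where "F v = (if vkind v = 2 then set (vlist v) - U (GS ! vgroup v)
    else U (GS ! vgroup v))" for v :: vertex
  have F: "F v \<subseteq> set (vlist v) \<and> card (F v) = vdemand v" if "v \<in> set W" for v
  proof -
    from that W obtain g where g: "g < length GS" and
      v: "v = selector g (GS ! g) \<or>
        (\<exists>S\<in>set (tests rows (length (blocks (GS ! g)))). v = tester g (blocks (GS ! g)) S)"
      by (auto simp: in_set_vertices)
    let ?B = "blocks (GS ! g)"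
    have G: "distinct (concat ?B)" "kind (GS ! g) < 2" "transversal (U (GS ! g)) ?B"
      using GS U g by (auto simp: group_instance_def group_solution_def block_system_def)
    from v show ?thesis
    proof
      assume "v = selector g (GS ! g)"
      then show ?thesis
        using G transversal_card[OF G(1,3)] by (auto simp: F_def selector_def transversal_def)
    next
      assume "\<exists>S\<in>set (tests rows (length ?B)). v = tester g ?B S"
      then obtain S where S: "S \<in> set (tests rows (length ?B))" "v = tester g ?B S" by blast
      note S' = in_tests[OF rows S(1)]
      have "card (set (block_union ?B S) - U (GS ! g)) =
          card (set (block_union ?B S)) - card (U (GS ! g) \<inter> set (block_union ?B S))"
        by (subst card_Diff_subset_Int) (auto simp: Int_commute)
      also have "\<dots> = length (block_union ?B S) - length S"
        using distinct_block_union[OF G(1) S'(1,2)] transversal_card_union[OF G(1,3) S'(1,2)]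
        by (simp add: distinct_card)
      finally show ?thesis by (auto simp: F_def S(2) tester_def)
    qed
  qed
  have shape: "GS ! vgroup v \<in> set GS \<and>
      (vkind v = 2 \<and> vvars v = [] \<and> F v = set (vlist v) - U (GS ! vgroup v) \<or>
       vkind v \<noteq> 2 \<and> vkind v = kind (GS ! vgroup v) \<and> vvars v = vars (GS ! vgroup v) \<and>
       F v = U (GS ! vgroup v))" if "v \<in> set W" for v
  proof -
    from that[unfolded W in_set_vertices] obtain g where g: "g < length GS"
      "v = selector g (GS ! g) \<or> (\<exists>S. v = tester g (blocks (GS ! g)) S)"
      by blast
    have "kind (GS ! g) < 2" using GS g(1) by (simp add: group_instance_def)
    then show ?thesis
      using g by (auto simp: F_def selector_def tester_def)
  qed
  have disj: "F v \<inter> F w = {}" if "v \<in> set W" "w \<in> set W" "adjacent v w" for v w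
    using that(3) unfolding adjacent_def
  proof
    assume "vgroup v = vgroup w \<and> \<not> vkind v = vkind w"
    then show ?thesis using shape[OF that(1)] shape[OF that(2)] by auto
  next
    assume *: "vkind v = 0 \<and> vkind w = 1 \<and> (\<exists>x\<in>set (vvars v). x \<in> set (vvars w))"
    let ?G = "GS ! vgroup v" and ?H = "GS ! vgroup w"
    have "kind ?G = 0" "kind ?H = 1" "set (vars ?G) \<inter> set (vars ?H) \<noteq> {}"
      "F v = U ?G" "F w = U ?H" "?G \<in> set GS" "?H \<in> set GS"
      using * shape[OF that(1)] shape[OF that(2)] by auto
    then show ?thesis using U unfolding group_solution_def by metis
  qed
  have "list_multicoloring (gadget_graph W)
    (\<lambda>p. set (vlist (vertex_at W p))) (\<lambda>p. vdemand (vertex_at W p)) (\<lambda>p. F (W ! p))"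
    unfolding list_multicoloring_def
  proof (intro conjI ballI impI)
    fix p q assume "{p, q} \<in> edges (gadget_graph W)"
    then show "F (W ! p) \<inter> F (W ! q) = {}"
      using disj[of "W ! p" "W ! q"] disj[of "W ! q" "W ! p"] by (auto simp: gadget_graph_edge)
  next
    fix p assume "p \<in> verts (gadget_graph W)"
    then have "p < length W" by simp
    then show "F (W ! p) \<subseteq> set (vlist (vertex_at W p))" "card (F (W ! p)) = vdemand (vertex_at W p)"
      using F[of "W ! p"] by (simp_all add: vertex_at_nth)
  qed
  then show ?thesis unfolding list_multicolorable_def by blast
qed

lemma group_solution_if_multicolorable:
  assumes rows: "rows_below d rows" "detecting d rows" and GS: "group_instance d GS"
    and W: "W = vertices rows GS"
    and col: "list_multicolorable (gadget_graph W)
      (\<lambda>p. set (vlist (vertex_at W p))) (\<lambda>p. vdemand (vertex_at W p))"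
  shows "\<exists>U. group_solution GS U"
proof -
  from col obtain f where lm: "list_multicoloring (gadget_graph W)
      (\<lambda>p. set (vlist (vertex_at W p))) (\<lambda>p. vdemand (vertex_at W p)) f"
    unfolding list_multicolorable_def by blast
  have f: "f p \<subseteq> set (vlist (W ! p)) \<and> card (f p) = vdemand (W ! p)" if "p < length W" for p
    using lm that unfolding list_multicoloring_def by (simp add: vertex_at_nth)
  have disj: "f p \<inter> f q = {}" if "p < length W" "q < length W" "adjacent (W ! p) (W ! q)" for p q
    using lm that unfolding list_multicoloring_def by (simp add: gadget_graph_edge)
  have "\<exists>p g. p < length W \<and> g < length GS \<and> W ! p = selector g G \<and> GS ! g = G" if "G \<in> set GS" for G
  proof -
    from that obtain g where g: "g < length GS" "GS ! g = G" by (auto simp: in_set_conv_nth)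
    then have "selector g G \<in> set W" unfolding W in_set_vertices by auto
    with g show ?thesis by (metis in_set_conv_nth)
  qed
  \<comment> \<open>A group may occur at several positions; one selector is chosen for each
    group.\<close>
  then obtain p g where pg: "\<And>G. G \<in> set GS \<Longrightarrow>
      p G < length W \<and> g G < length GS \<and> W ! p G = selector (g G) G \<and> GS ! g G = G"
    by metis
  have "group_solution GS (\<lambda>G. f (p G))"
    unfolding group_solution_def
  proof (intro conjI ballI impI)
    fix G assume G: "G \<in> set GS"
    let ?B = "blocks G"
    have B: "block_system d ?B" "kind G < 2" using GS G by (auto simp: group_instance_def)
    note pG = pg[OF G]
    have X: "f (p G) \<subseteq> set (concat ?B)" "card (f (p G)) = length ?B"
      using f[of "p G"] pG by (auto simp: selector_def)
    show "transversal (f (p G)) ?B"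
    proof (rule transversalI_tests[OF rows B(1) X])
      fix S assume S: "S \<in> set (tests rows (length ?B))"
      let ?T = "block_union ?B S"
      note S' = in_tests[OF rows(1) S]
      have "tester (g G) ?B S \<in> set W"
        unfolding W in_set_vertices using pG S by metis
      then obtain q where q: "q < length W" "W ! q = tester (g G) ?B S"
        by (metis in_set_conv_nth)
      have "adjacent (W ! p G) (W ! q)"
        using pG q B(2) by (simp add: adjacent_def selector_def tester_def)
      then have "f (p G) \<inter> f q = {}"
        using disj pG q(1) by blast
      moreover have "f q \<subseteq> set ?T" "card (f q) = length ?T - length S"
        using f[OF q(1)] q(2) by (auto simp: tester_def)
      \<comment> \<open>The colors of the tester fit into the part of its list that the selector
        leaves free.\<close>
      ultimately have "length ?T - length S \<le> card (set ?T - f (p G))"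
        using card_mono[of "set ?T - f (p G)" "f q"] by fastforce
      moreover have "card (set ?T) = card (set ?T \<inter> f (p G)) + card (set ?T - f (p G))"
        by (rule card_Int_Diff) simp
      then have "card (set ?T) = card (set ?T - f (p G)) + card (f (p G) \<inter> set ?T)"
        by (simp add: Int_commute)
      moreover have "card (set ?T) = length ?T"
        using B(1) S' by (intro distinct_card distinct_block_union) (auto simp: block_system_def)
      \<comment> \<open>Excludes truncation in the natural subtraction of the demand.\<close>
      moreover have "length S \<le> length ?T"
        using length_block_union_ge(1)[OF B(1) S'(2)] by simp
      ultimately show "card (f (p G) \<inter> set ?T) \<le> length S" by linarith
    qed
  next
    fix G H assume *: "G \<in> set GS" "H \<in> set GS" "kind G = 0" "kind H = 1" "set (vars G) \<inter> set (vars H) \<noteq> {}"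
    have "adjacent (W ! p G) (W ! p H)"
      using pg[OF *(1)] pg[OF *(2)] *(3-5) by (auto simp: adjacent_def selector_def)
    then show "f (p G) \<inter> f (p H) = {}"
      using disj pg[OF *(1)] pg[OF *(2)] by blast
  qed
  then show ?thesis by blast
qed

section \<open>Demands, lists and number of vertices\<close>

text \<open>Blocks of 2 or 3 colors give a tester for \<open>S\<close> between
  \<open>2 * length S\<close> and \<open>3 * length S\<close> colors, so its demand lies between
  \<open>length S\<close> and \<open>2 * length S\<close>. This is the origin of the bound
  \<open>2 * d\<close>; a selector demands at most \<open>d\<close>.\<close>

lemma vertices_bounds:
  assumes rows: "rows_below d rows" and GS: "group_instance d GS"
    and v: "v \<in> set (vertices rows GS)"
  shows "vkind v < 3" "1 \<le> vdemand v" "vdemand v \<le> 2 * d"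
    "set (vlist v) \<subseteq> (\<Union>G\<in>set GS. set (concat (blocks G)))"
proof -
  from v obtain g where g: "g < length GS" and
    v: "v = selector g (GS ! g) \<or>
      (\<exists>S\<in>set (tests rows (length (blocks (GS ! g)))). v = tester g (blocks (GS ! g)) S)"
    by (auto simp: in_set_vertices)
  let ?B = "blocks (GS ! g)"
  have G: "GS ! g \<in> set GS" "kind (GS ! g) < 2" "?B \<noteq> []" "block_system d ?B"
    using g GS by (auto simp: group_instance_def)
  have "vkind v < 3 \<and> 1 \<le> vdemand v \<and> vdemand v \<le> 2 * d \<and> set (vlist v) \<subseteq> set (concat ?B)"
    using v
  proof
    assume "v = selector g (GS ! g)"
    then show ?thesis
      using G(2-4) by (auto simp: selector_def block_system_def Suc_le_eq)
  next
    assume "\<exists>S\<in>set (tests rows (length ?B)). v = tester g ?B S"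
    then obtain S where S: "S \<in> set (tests rows (length ?B))" "v = tester g ?B S" by blast
    note S' = in_tests[OF rows S(1)]
    have "length S \<le> length ?B"
      using S'(1,2) by (metis card_lessThan card_mono distinct_card finite_lessThan)
    moreover have "length ?B \<le> d" using G(4) by (simp add: block_system_def)
    moreover note length_block_union_ge[OF G(4) S'(2)]
    moreover have "length S \<ge> 1" using S'(3) by (simp add: Suc_le_eq)
    moreover have "set (block_union ?B S) \<subseteq> set (concat ?B)"
      using S'(2) by (auto simp: set_block_union nth_default_def intro: bexI[OF _ nth_mem])
    ultimately have "1 \<le> length (block_union ?B S) - length S"
      "length (block_union ?B S) - length S \<le> 2 * d" "set (block_union ?B S) \<subseteq> set (concat ?B)"
      by linarith+
    then show ?thesis by (simp add: S(2) tester_def)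
  qed
  then show "vkind v < 3" "1 \<le> vdemand v" "vdemand v \<le> 2 * d"
    "set (vlist v) \<subseteq> (\<Union>G\<in>set GS. set (concat (blocks G)))"
    using G(1) by blast+
qed

lemma length_vertices_le: "length (vertices rows GS) \<le> length GS * (1 + 2 * length rows)"
proof -
  have "length (tests rows m) \<le> 2 * length rows" for m
    unfolding tests_def Let_def by (rule order_trans[OF length_filter_le]) simp
  then have *: "length (gadget rows g G) \<le> 1 + 2 * length rows" for g G
    by (simp add: gadget_def)
  have "sum_list (map (\<lambda>g. length (gadget rows g (nth_default (0, [], []) GS g))) xs)
      \<le> length xs * (1 + 2 * length rows)" for xs
  proof (induction xs)
    case (Cons x xs)
    from add_mono[OF *[of x "nth_default (0, [], []) GS x"] this]
    show ?case by (simp add: algebra_simps)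
  qed simp
  from this[of "[0..<length GS]"] show ?thesis
    by (simp add: vertices_def length_concat comp_def)
qed

section \<open>Groups of variables and clauses\<close>

definition var_groups :: "nat \<Rightarrow> nat \<Rightarrow> nat list list" where
  "var_groups d n = chunks d [0..<n]"

definition share :: "cnf \<Rightarrow> nat \<Rightarrow> nat \<Rightarrow> bool" where
  "share \<phi> i j \<longleftrightarrow>
     (\<exists>l\<in>set (nth_default [] \<phi> i). \<exists>k\<in>set (nth_default [] \<phi> j). fst l = fst k)"

text \<open>Each of the three variables of a clause occurs in at most 4 clauses, so at most 12
  earlier clauses share a variable with it, and 13 classes suffice.\<close>

definition clause_classes :: "cnf \<Rightarrow> nat list" where
  "clause_classes \<phi> = greedy (share \<phi>) (length \<phi>)"

definition clause_groups :: "nat \<Rightarrow> cnf \<Rightarrow> nat list list" where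
  "clause_groups d \<phi> = concat (map (\<lambda>c. chunks d
     (filter (\<lambda>i. nth_default 0 (clause_classes \<phi>) i = c) [0..<length \<phi>])) [0..<13])"

definition group_lits :: "cnf \<Rightarrow> nat list \<Rightarrow> literal list" where
  "group_lits \<phi> J = concat (map (nth_default [] \<phi>) J)"

definition group_vars :: "cnf \<Rightarrow> nat list \<Rightarrow> nat list" where
  "group_vars \<phi> J = map fst (group_lits \<phi> J)"

text \<open>A common color in the first case would make blocks of one selector overlap. In the
  second case the disjointness of adjacent selectors would tie unrelated variables to each
  other.\<close>

definition conflict :: "nat list list \<Rightarrow> nat list list \<Rightarrow> nat \<Rightarrow> nat \<Rightarrow> bool" where
  "conflict VG CV x y \<longleftrightarrow>
     (\<exists>V\<in>set VG. x \<in> set V \<and> y \<in> set V) \<or>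
     (\<exists>J\<in>set CV. \<exists>V\<in>set VG. (\<exists>z\<in>set V. z \<in> set J) \<and>
        (x \<in> set J \<and> y \<in> set V \<or> y \<in> set J \<and> x \<in> set V))"

definition var_colors :: "nat \<Rightarrow> nat \<Rightarrow> cnf \<Rightarrow> nat list" where
  "var_colors d n \<phi> =
     greedy (conflict (var_groups d n) (map (group_vars \<phi>) (clause_groups d \<phi>))) n"

definition lit_color :: "nat list \<Rightarrow> literal \<Rightarrow> nat" where
  "lit_color \<gamma> l = 2 * nth_default 0 \<gamma> (fst l) + (if snd l then 1 else 0)"

definition var_group :: "nat list \<Rightarrow> nat list \<Rightarrow> group" where
  "var_group \<gamma> V = (0, V, map (\<lambda>x. map (lit_color \<gamma>) [(x, False), (x, True)]) V)"

definition clause_group :: "nat list \<Rightarrow> cnf \<Rightarrow> nat list \<Rightarrow> group" where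
  "clause_group \<gamma> \<phi> J =
     (1, group_vars \<phi> J, map (\<lambda>i. map (lit_color \<gamma>) (nth_default [] \<phi> i)) J)"

definition sat_groups :: "nat \<Rightarrow> nat \<Rightarrow> cnf \<Rightarrow> group list" where
  "sat_groups d n \<phi> =
     map (var_group (var_colors d n \<phi>)) (var_groups d n) @
     map (clause_group (var_colors d n \<phi>) \<phi>) (clause_groups d \<phi>)"

lemma conflict_sym: "conflict VG CV x y \<Longrightarrow> conflict VG CV y x"
  unfolding conflict_def by blast

lemma lit_color_eq:
  "lit_color \<gamma> l = lit_color \<gamma> k \<longleftrightarrow>
     nth_default 0 \<gamma> (fst l) = nth_default 0 \<gamma> (fst k) \<and> snd l = snd k"
proof -
  have "2 * a + (if p then 1 else 0) = 2 * b + (if q then 1 else 0) \<longleftrightarrow> a = b \<and> p = q"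
    for a b :: nat and p q by (cases p; cases q; presburger)
  then show ?thesis unfolding lit_color_def .
qed

lemma sum_length_filter_le: "(\<Sum>c<k. length (filter (\<lambda>i. f i = c) xs)) \<le> length xs"
  for f :: "'a \<Rightarrow> nat"
proof (induction xs)
  case (Cons x xs)
  have "(\<Sum>c<k. length (filter (\<lambda>i. f i = c) (x # xs))) =
        (\<Sum>c<k. (if f x = c then 1 else 0) + length (filter (\<lambda>i. f i = c) xs))"
    by (intro sum.cong refl) simp
  also have "\<dots> = (\<Sum>c<k. if f x = c then 1 else 0) + (\<Sum>c<k. length (filter (\<lambda>i. f i = c) xs))"
    by (rule sum.distrib)
  also have "\<dots> \<le> 1 + length xs"
  proof (rule add_mono[OF _ Cons])
    show "(\<Sum>c<k. if f x = c then 1 else 0 :: nat) \<le> 1" by simp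
  qed
  finally show ?case by simp
qed simp

lemma length_concat_map_upt:
  "d * length (concat (map g [0..<k])) = (\<Sum>c<k. d * length (g c))"
  by (induction k) (auto simp: algebra_simps)

section \<open>Sizes and disjointness of the groups\<close>

context
  fixes d n :: nat and \<phi> :: cnf
  assumes inst: "sat34_instance n \<phi>" and d: "d \<ge> 1"
begin

lemma clause_props:
  assumes "i < length \<phi>"
  shows "length (\<phi> ! i) = 3" "distinct (map fst (\<phi> ! i))" "fst ` set (\<phi> ! i) \<subseteq> {..<n}"
  using inst nth_mem[OF assms] unfolding sat34_instance_def clause_vars_def by blast+

definition occ :: "nat \<Rightarrow> nat set" where
  "occ x = {i. i < length \<phi> \<and> x \<in> fst ` set (\<phi> ! i)}"

lemma finite_occ: "finite (occ x)"
  unfolding occ_def by simp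

lemma card_occ: "card (occ x) \<le> 4"
proof (cases "x < n")
  case True
  then have "length (filter (\<lambda>C. x \<in> clause_vars C) \<phi>) \<le> 4"
    using inst unfolding sat34_instance_def by blast
  then show ?thesis
    by (simp add: length_filter_conv_card occ_def clause_vars_def)
next
  case False
  then have "occ x = {}"
    using clause_props(3) unfolding occ_def by auto
  then show ?thesis by simp
qed

text \<open>Every clause is found among the occurrences of its first variable, and each variable has
  at most 4 occurrences.\<close>

lemma length_le_vars: "length \<phi> \<le> 4 * n"
proof -
  have "i \<in> (\<Union>x<n. occ x)" if "i < length \<phi>" for i
  proof -
    have "\<phi> ! i \<noteq> []" using clause_props(1)[OF that] by auto
    then have "fst (hd (\<phi> ! i)) \<in> fst ` set (\<phi> ! i)" by simp
    then show ?thesis using clause_props(3)[OF that] that unfolding occ_def by blast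
  qed
  then have "card {..<length \<phi>} \<le> card (\<Union>x<n. occ x)"
    by (intro card_mono) (auto intro: finite_occ)
  also have "\<dots> \<le> (\<Sum>x<n. card (occ x))"
    by (rule card_UN_le) simp
  also have "\<dots> \<le> (\<Sum>x<n. 4)"
    by (rule sum_mono) (rule card_occ)
  finally show ?thesis by simp
qed

lemma share_iff:
  assumes "i < length \<phi>" "j < length \<phi>"
  shows "share \<phi> i j \<longleftrightarrow> fst ` set (\<phi> ! i) \<inter> fst ` set (\<phi> ! j) \<noteq> {}"
  using assms unfolding share_def by (force simp: nth_default_def)

lemma clause_classes_lt:
  assumes "i < length \<phi>"
  shows "nth_default 0 (clause_classes \<phi>) i < 13"
proof -
  have "{j. j < i \<and> share \<phi> i j} \<subseteq> (\<Union>x\<in>fst ` set (\<phi> ! i). occ x)"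
  proof
    fix j assume "j \<in> {j. j < i \<and> share \<phi> i j}"
    then have "j < length \<phi>" "share \<phi> i j" using assms by auto
    then show "j \<in> (\<Union>x\<in>fst ` set (\<phi> ! i). occ x)"
      unfolding share_iff[OF assms \<open>j < length \<phi>\<close>] occ_def by blast
  qed
  then have "card {j. j < i \<and> share \<phi> i j} \<le> card (\<Union>x\<in>fst ` set (\<phi> ! i). occ x)"
    by (rule card_mono[rotated]) (auto intro: finite_occ)
  also have "\<dots> \<le> (\<Sum>x\<in>fst ` set (\<phi> ! i). card (occ x))"
    by (rule card_UN_le) simp
  also have "\<dots> \<le> (\<Sum>x\<in>fst ` set (\<phi> ! i). 4)"
    by (rule sum_mono) (rule card_occ)
  also have "\<dots> \<le> 12"
  proof -
    have "card (fst ` set (\<phi> ! i)) \<le> 3"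
      using card_length[of "map fst (\<phi> ! i)"] clause_props(1)[OF assms] by simp
    then show ?thesis by simp
  qed
  finally show ?thesis
    using greedy_le_card[OF assms, of "share \<phi>"] assms
    by (simp add: clause_classes_def nth_default_def)
qed

lemma clause_classes_proper:
  assumes "i < length \<phi>" "j < length \<phi>" "i \<noteq> j" "share \<phi> i j"
  shows "nth_default 0 (clause_classes \<phi>) i \<noteq> nth_default 0 (clause_classes \<phi>) j"
proof -
  have "share \<phi> j i" using assms(4) unfolding share_def by metis
  then show ?thesis
    using greedy_proper[of i j "length \<phi>" "share \<phi>"] greedy_proper[of j i "length \<phi>" "share \<phi>"] assms
    by (cases "i < j") (auto simp: clause_classes_def nth_default_def)
qed

abbreviation class_list :: "nat \<Rightarrow> nat list" where
  "class_list c \<equiv> filter (\<lambda>i. nth_default 0 (clause_classes \<phi>) i = c) [0..<length \<phi>]"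

lemma in_clause_groups:
  "J \<in> set (clause_groups d \<phi>) \<longleftrightarrow> (\<exists>c<13. J \<in> set (chunks d (class_list c)))"
  by (auto simp: clause_groups_def)

lemma clause_group_class:
  assumes "J \<in> set (chunks d (class_list c))"
  shows "set J \<subseteq> {i. i < length \<phi> \<and> nth_default 0 (clause_classes \<phi>) i = c}"
proof -
  have "set J \<subseteq> set (class_list c)"
    using assms set_chunks[OF d, of "class_list c"] by blast
  then show ?thesis by auto
qed

lemma clause_group_props:
  assumes "J \<in> set (clause_groups d \<phi>)"
  shows "J \<noteq> []" "length J \<le> d" "distinct J" "set J \<subseteq> {..<length \<phi>}"
    and "i \<in> set J \<Longrightarrow> j \<in> set J \<Longrightarrow> i \<noteq> j \<Longrightarrow> \<not> share \<phi> i j"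
proof -
  from assms obtain c where c: "J \<in> set (chunks d (class_list c))"
    by (auto simp: in_clause_groups)
  show "J \<noteq> []" "length J \<le> d" "distinct J"
    using in_set_chunks[OF c] distinct_chunk[OF d _ c] by auto
  note * = clause_group_class[OF c]
  show "set J \<subseteq> {..<length \<phi>}" using * by auto
  show "\<not> share \<phi> i j" if "i \<in> set J" "j \<in> set J" "i \<noteq> j"
    using clause_classes_proper[of i j] * that by blast
qed

text \<open>The class of \<open>i\<close> determines the class from which the group was cut, and the
  chunks of one class are disjoint.\<close>

lemma clause_group_unique:
  assumes "J \<in> set (clause_groups d \<phi>)" "K \<in> set (clause_groups d \<phi>)" "i \<in> set J" "i \<in> set K"
  shows "J = K"
proof -
  from assms obtain c e where *: "J \<in> set (chunks d (class_list c))" "K \<in> set (chunks d (class_list e))"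
    by (auto simp: in_clause_groups)
  then have "c = e"
    using clause_group_class assms(3,4) by blast
  then show ?thesis
    using chunk_unique[OF d, of "class_list c"] * assms(3,4) by simp
qed

lemma clause_group_exists:
  assumes "i < length \<phi>"
  shows "\<exists>J\<in>set (clause_groups d \<phi>). i \<in> set J"
proof -
  let ?c = "nth_default 0 (clause_classes \<phi>) i"
  have "i \<in> set (class_list ?c)" using assms by simp
  then obtain J where "J \<in> set (chunks d (class_list ?c))" "i \<in> set J"
    using set_chunks[OF d, of "class_list ?c"] by blast
  then show ?thesis using clause_classes_lt[OF assms] in_clause_groups by blast
qed

text \<open>Each of the 13 classes adds at most one incomplete chunk, which accounts for
  \<open>13 * d\<close>.\<close>

lemma length_clause_groups: "d * length (clause_groups d \<phi>) \<le> 4 * n + 13 * d"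
proof -
  have "d * length (clause_groups d \<phi>) = (\<Sum>c<13. d * length (chunks d (class_list c)))"
    unfolding clause_groups_def by (rule length_concat_map_upt)
  also have "\<dots> \<le> (\<Sum>c<13. length (class_list c) + d)"
  proof (rule sum_mono)
    fix c
    have "d * length (chunks d (class_list c)) \<le> d * (length (class_list c) div d + 1)"
      using length_chunks_le[OF d, of "class_list c"] by (rule mult_left_mono) simp
    also have "\<dots> \<le> length (class_list c) + d"
      by (simp add: algebra_simps)
    finally show "d * length (chunks d (class_list c)) \<le> length (class_list c) + d" .
  qed
  also have "\<dots> = (\<Sum>c<13. length (class_list c)) + 13 * d"
    unfolding sum.distrib by simp
  also have "\<dots> \<le> length [0..<length \<phi>] + 13 * d"
    by (intro add_right_mono sum_length_filter_le)
  also have "\<dots> \<le> 4 * n + 13 * d"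
    using length_le_vars by simp
  finally show ?thesis .
qed

lemma length_var_groups: "d * length (var_groups d n) \<le> n + d"
proof -
  have "d * length (var_groups d n) \<le> d * (n div d + 1)"
    using length_chunks_le[OF d, of "[0..<n]"] unfolding var_groups_def by (intro mult_left_mono) auto
  also have "\<dots> \<le> n + d" by (simp add: algebra_simps)
  finally show ?thesis .
qed

lemma set_group_lits:
  assumes "J \<in> set (clause_groups d \<phi>)"
  shows "set (group_lits \<phi> J) = (\<Union>i\<in>set J. set (\<phi> ! i))"
  using clause_group_props(4)[OF assms] by (auto simp: group_lits_def nth_default_def)

lemma in_group_vars:
  assumes "J \<in> set (clause_groups d \<phi>)"
  shows "x \<in> set (group_vars \<phi> J) \<longleftrightarrow> (\<exists>i\<in>set J. i \<in> occ x)"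
  using clause_group_props(4)[OF assms]
  unfolding group_vars_def set_map set_group_lits[OF assms] occ_def by auto

lemma distinct_group_vars:
  assumes "J \<in> set (clause_groups d \<phi>)"
  shows "distinct (group_vars \<phi> J)"
proof -
  have "distinct (map fst (concat (map (nth_default [] \<phi>) I)))"
    if "set I \<subseteq> set J" "distinct I" for I
    using that
  proof (induction I)
    case (Cons i I)
    have i: "i < length \<phi>" using Cons.prems clause_group_props(4)[OF assms] by auto
    have "fst ` set (nth_default [] \<phi> i) \<inter> fst ` set (nth_default [] \<phi> j) = {}" if "j \<in> set I" for j
    proof -
      have "\<not> share \<phi> i j"
        using clause_group_props(5)[OF assms, of i j] Cons.prems that by auto
      then show ?thesis unfolding share_def by blast
    qed
    then show ?case
      using Cons clause_props(2)[OF i] i by (auto simp: nth_default_def)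
  qed simp
  then show ?thesis
    using clause_group_props(3)[OF assms] unfolding group_vars_def group_lits_def by blast
qed

lemma length_group_vars:
  assumes "J \<in> set (clause_groups d \<phi>)"
  shows "length (group_vars \<phi> J) \<le> 3 * d"
proof -
  have "length (concat (map (nth_default [] \<phi>) I)) = 3 * length I" if "set I \<subseteq> set J" for I
    using that clause_group_props(4)[OF assms] clause_props(1)
    by (induction I) (auto simp: nth_default_def)
  from this[OF order_refl] show ?thesis
    using clause_group_props(2)[OF assms] by (simp add: group_vars_def group_lits_def)
qed

lemma group_vars_lt: "J \<in> set (clause_groups d \<phi>) \<Longrightarrow> set (group_vars \<phi> J) \<subseteq> {..<n}"
  using clause_props(3) unfolding subset_iff by (auto simp: in_group_vars occ_def)

lemma var_group_props:
  assumes "V \<in> set (var_groups d n)"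
  shows "V \<noteq> []" "length V \<le> d" "distinct V" "set V \<subseteq> {..<n}"
proof -
  show "V \<noteq> []" "length V \<le> d" "distinct V"
    using assms in_set_chunks distinct_chunk[OF d, of "[0..<n]" V] unfolding var_groups_def by auto
  show "set V \<subseteq> {..<n}"
    using assms set_chunks[OF d, of "[0..<n]"] unfolding var_groups_def by auto
qed

lemma var_group_unique:
  "V \<in> set (var_groups d n) \<Longrightarrow> V' \<in> set (var_groups d n) \<Longrightarrow> x \<in> set V \<Longrightarrow> x \<in> set V' \<Longrightarrow> V = V'"
  using chunk_unique[OF d, of "[0..<n]"] unfolding var_groups_def by simp

lemma var_group_exists: "x < n \<Longrightarrow> \<exists>V\<in>set (var_groups d n). x \<in> set V"
  using set_chunks[OF d, of "[0..<n]"] unfolding var_groups_def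
  by (metis UN_iff atLeastLessThan_iff le0 set_upt)

section \<open>Conflicts between variables and their colors\<close>

abbreviation confl :: "nat \<Rightarrow> nat \<Rightarrow> bool" where
  "confl \<equiv> conflict (var_groups d n) (map (group_vars \<phi>) (clause_groups d \<phi>))"

abbreviation \<gamma> :: "nat list" where "\<gamma> \<equiv> var_colors d n \<phi>"

text \<open>Beyond the at most \<open>d\<close> variables in the group of \<open>x\<close> there are
  two routes to a conflict. One leads from \<open>x\<close> through one of its 4 occurrences to a
  clause group, to one of its \<open>3 * d\<close> variables and on to the variable group of that
  variable. The other starts in the variable group of \<open>x\<close> and ends in a clause group.
  Each reaches at most 12 d^2 variables.\<close>

lemma card_confl: "card {y. y < n \<and> confl x y} \<le> 25 * d\<^sup>2"
proof -
  define VX where "VX = (\<Union>V\<in>{V\<in>set (var_groups d n). x \<in> set V}. set V)"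
  define VO where "VO z = (\<Union>V\<in>{V\<in>set (var_groups d n). z \<in> set V}. set V)" for z
  define JO where "JO i = (\<Union>J\<in>{J\<in>set (clause_groups d \<phi>). i \<in> set J}. set (group_vars \<phi> J))" for i
  have fin [simp]: "finite (VO z)" "finite (JO i)" for z i
    unfolding VO_def JO_def by auto
  have VO: "card (VO z) \<le> d" for z
  proof (cases "\<exists>V\<in>set (var_groups d n). z \<in> set V")
    case True
    then obtain V where V: "V \<in> set (var_groups d n)" "z \<in> set V" by blast
    then have "{V\<in>set (var_groups d n). z \<in> set V} = {V}" using var_group_unique by blast
    then show ?thesis
      using var_group_props(2)[OF V(1)] card_length[of V] unfolding VO_def by simp
  next
    case False
    then have "VO z = {}" unfolding VO_def by blast
    then show ?thesis by simp
  qed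
  have JO: "card (JO i) \<le> 3 * d" for i
  proof (cases "\<exists>J\<in>set (clause_groups d \<phi>). i \<in> set J")
    case True
    then obtain J where J: "J \<in> set (clause_groups d \<phi>)" "i \<in> set J" by blast
    then have "{J\<in>set (clause_groups d \<phi>). i \<in> set J} = {J}" using clause_group_unique by blast
    then show ?thesis
      using length_group_vars[OF J(1)] card_length[of "group_vars \<phi> J"] unfolding JO_def by simp
  next
    case False
    then have "JO i = {}" unfolding JO_def by blast
    then show ?thesis by simp
  qed
  have UN: "card (\<Union>a\<in>A. F a) \<le> k * m" if "finite A" "card A \<le> k" "\<And>a. card (F a) \<le> m"
    for A :: "nat set" and F :: "nat \<Rightarrow> nat set" and k m
  proof -
    have "card (\<Union>a\<in>A. F a) \<le> (\<Sum>a\<in>A. card (F a))" by (rule card_UN_le[OF that(1)])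
    also have "\<dots> \<le> card A * m" using sum_bounded_above[of A "\<lambda>a. card (F a)" m] that(3) by simp
    also have "\<dots> \<le> k * m" using that(2) by (rule mult_right_mono) simp
    finally show ?thesis .
  qed
  let ?A = "\<Union>i\<in>occ x. \<Union>z\<in>JO i. VO z" and ?B = "\<Union>z\<in>VO x. \<Union>i\<in>occ z. JO i"
  have "{y. y < n \<and> confl x y} \<subseteq> VO x \<union> (?A \<union> ?B)"
  proof
    fix y assume "y \<in> {y. y < n \<and> confl x y}"
    then have "confl x y" by simp
    then consider V where "V \<in> set (var_groups d n)" "x \<in> set V" "y \<in> set V"
      | J V z where "J \<in> set (clause_groups d \<phi>)" "V \<in> set (var_groups d n)" "z \<in> set V"
        "z \<in> set (group_vars \<phi> J)" "x \<in> set (group_vars \<phi> J)" "y \<in> set V"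
      | J V z where "J \<in> set (clause_groups d \<phi>)" "V \<in> set (var_groups d n)" "z \<in> set V"
        "z \<in> set (group_vars \<phi> J)" "y \<in> set (group_vars \<phi> J)" "x \<in> set V"
      unfolding conflict_def by auto
    then show "y \<in> VO x \<union> (?A \<union> ?B)"
    proof cases
      case 1
      then show ?thesis unfolding VO_def by blast
    next
      case 2
      from 2(5) obtain i where "i \<in> set J" "i \<in> occ x" using in_group_vars[OF 2(1)] by blast
      then have "z \<in> JO i" "y \<in> VO z" using 2 unfolding JO_def VO_def by blast+
      then show ?thesis using \<open>i \<in> occ x\<close> by blast
    next
      case 3
      from 3(4) obtain i where "i \<in> set J" "i \<in> occ z" using in_group_vars[OF 3(1)] by blast
      then have "y \<in> JO i" "z \<in> VO x" using 3 unfolding JO_def VO_def by blast+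
      then show ?thesis using \<open>i \<in> occ z\<close> by blast
    qed
  qed
  then have "card {y. y < n \<and> confl x y} \<le> card (VO x \<union> (?A \<union> ?B))"
    by (rule card_mono[rotated]) (auto intro: finite_occ)
  also have "\<dots> \<le> card (VO x) + (card ?A + card ?B)"
    by (meson add_left_mono card_Un_le order_trans)
  also have "\<dots> \<le> d + (4 * (3 * d * d) + d * (4 * (3 * d)))"
    by (intro add_mono VO UN JO finite_occ card_occ fin)
  also have "\<dots> \<le> 25 * d\<^sup>2"
    using d by (simp add: power2_eq_square)
  finally show ?thesis .
qed

lemma var_colors_le:
  assumes "x < n"
  shows "nth_default 0 \<gamma> x \<le> 25 * d\<^sup>2"
proof -
  have "nth_default 0 \<gamma> x \<le> card {y. y < x \<and> confl x y}"
    using greedy_le_card[OF assms] assms by (simp add: var_colors_def nth_default_def)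
  also have "\<dots> \<le> card {y. y < n \<and> confl x y}"
    using assms by (intro card_mono) auto
  finally show ?thesis using card_confl[of x] by linarith
qed

lemma var_colors_inj:
  assumes "x < n" "y < n" "confl x y" "nth_default 0 \<gamma> x = nth_default 0 \<gamma> y"
  shows "x = y"
  using greedy_proper[of x y n confl] greedy_proper[of y x n confl] assms conflict_sym[OF assms(3)]
  by (cases x y rule: linorder_cases) (auto simp: var_colors_def nth_default_def)

lemma confl_var_group: "V \<in> set (var_groups d n) \<Longrightarrow> x \<in> set V \<Longrightarrow> y \<in> set V \<Longrightarrow> confl x y"
  unfolding conflict_def by blast

lemma confl_clause_var:
  assumes "J \<in> set (clause_groups d \<phi>)" "V \<in> set (var_groups d n)"
    "set V \<inter> set (group_vars \<phi> J) \<noteq> {}" "x \<in> set V" "y \<in> set (group_vars \<phi> J)"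
  shows "confl x y"
  using assms unfolding conflict_def by fastforce

text \<open>The variable group of \<open>x\<close> meets the clause group in \<open>x\<close>
  itself, so \<open>confl_clause_var\<close> applies.\<close>

lemma confl_clause_group:
  assumes "J \<in> set (clause_groups d \<phi>)" "x \<in> set (group_vars \<phi> J)" "y \<in> set (group_vars \<phi> J)"
  shows "confl x y"
proof -
  have "x < n" using group_vars_lt[OF assms(1)] assms(2) by auto
  then obtain V where "V \<in> set (var_groups d n)" "x \<in> set V" using var_group_exists by blast
  then show ?thesis using confl_clause_var[OF assms(1)] assms(2,3) by blast
qed

lemma distinct_lit_colors:
  assumes "distinct ls" "fst ` set ls \<subseteq> A" "A \<subseteq> {..<n}" "\<And>x y. x \<in> A \<Longrightarrow> y \<in> A \<Longrightarrow> confl x y"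
  shows "distinct (map (lit_color \<gamma>) ls)"
proof -
  have "l = k" if "l \<in> set ls" "k \<in> set ls" "lit_color \<gamma> l = lit_color \<gamma> k" for l k
  proof -
    have "fst l \<in> A" "fst k \<in> A" using that assms(2) by auto
    then have "fst l = fst k"
      using var_colors_inj[of "fst l" "fst k"] assms(3,4) that(3) unfolding lit_color_eq by blast
    then show ?thesis using that(3) unfolding lit_color_eq by (simp add: prod_eq_iff)
  qed
  then show ?thesis
    using assms(1) unfolding distinct_map inj_on_def by blast
qed

section \<open>Groups as block systems\<close>

lemma block_system_var_group:
  assumes "V \<in> set (var_groups d n)"
  shows "block_system d (blocks (var_group \<gamma> V))"
proof -
  let ?ls = "concat (map (\<lambda>x. [(x, False), (x, True)]) V)"
  have "distinct (map (lit_color \<gamma>) ?ls)"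
  proof (rule distinct_lit_colors[OF _ _ var_group_props(4)[OF assms] confl_var_group[OF assms]])
    show "distinct ?ls" using var_group_props(3)[OF assms] by (induction V) auto
  qed auto
  moreover have "concat (blocks (var_group \<gamma> V)) = map (lit_color \<gamma>) ?ls"
    by (simp add: var_group_def map_concat comp_def)
  ultimately have "distinct (concat (blocks (var_group \<gamma> V)))" by simp
  then show ?thesis
    using var_group_props(2)[OF assms] unfolding block_system_def by (auto simp: var_group_def)
qed

lemma block_system_clause_group:
  assumes "J \<in> set (clause_groups d \<phi>)"
  shows "block_system d (blocks (clause_group \<gamma> \<phi> J))"
proof -
  have "concat (blocks (clause_group \<gamma> \<phi> J)) = map (lit_color \<gamma>) (group_lits \<phi> J)"
    by (simp add: clause_group_def group_lits_def map_concat comp_def)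
  moreover have "distinct (map (lit_color \<gamma>) (group_lits \<phi> J))"
  proof (rule distinct_lit_colors[OF _ _ group_vars_lt[OF assms] confl_clause_group[OF assms]])
    show "distinct (group_lits \<phi> J)"
      using distinct_group_vars[OF assms] unfolding group_vars_def by (simp add: distinct_map)
  qed (simp add: group_vars_def)
  ultimately have "distinct (concat (blocks (clause_group \<gamma> \<phi> J)))" by simp
  then show ?thesis
    using clause_group_props(2,4)[OF assms] clause_props(1) unfolding block_system_def
    by (auto simp: clause_group_def nth_default_def)
qed

lemma group_instance_sat_groups: "group_instance d (sat_groups d n \<phi>)"
  unfolding group_instance_def
proof
  fix G assume "G \<in> set (sat_groups d n \<phi>)"
  then consider V where "V \<in> set (var_groups d n)" "G = var_group \<gamma> V"
    | J where "J \<in> set (clause_groups d \<phi>)" "G = clause_group \<gamma> \<phi> J"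
    by (auto simp: sat_groups_def)
  then show "kind G < 2 \<and> block_system d (blocks G) \<and> blocks G \<noteq> []"
  proof cases
    case 1
    then show ?thesis
      using block_system_var_group var_group_props(1) by (simp add: var_group_def)
  next
    case 2
    then show ?thesis
      using block_system_clause_group clause_group_props(1) by (simp add: clause_group_def)
  qed
qed

text \<open>Doubling a variable color of at most 25 d^2 and adding the sign gives at most 50 d^2 +
  1, which is below 52 d^2 as \<open>d \<ge> 1\<close>.\<close>

lemma lit_color_lt:
  assumes "fst l < n"
  shows "lit_color \<gamma> l < 52 * d\<^sup>2"
proof -
  have "lit_color \<gamma> l \<le> 50 * d\<^sup>2 + 1"
    using var_colors_le[OF assms] unfolding lit_color_def by simp
  moreover have "d\<^sup>2 \<ge> 1" using d by simp
  ultimately show ?thesis by linarith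
qed

lemma sat_groups_colors:
  assumes "G \<in> set (sat_groups d n \<phi>)"
  shows "set (concat (blocks G)) \<subseteq> {..<52 * d\<^sup>2}"
proof -
  consider V where "V \<in> set (var_groups d n)" "G = var_group \<gamma> V"
    | J where "J \<in> set (clause_groups d \<phi>)" "G = clause_group \<gamma> \<phi> J"
    using assms by (auto simp: sat_groups_def)
  then show ?thesis
  proof cases
    case 1
    then show ?thesis
      using var_group_props(4)[OF 1(1)] lit_color_lt by (auto simp: var_group_def)
  next
    case 2
    then have "fst l < n" if "i \<in> set J" "l \<in> set (nth_default [] \<phi> i)" for i l
      using clause_group_props(4)[OF 2(1)] clause_props(3)[of i] that
      by (auto simp: nth_default_def split: if_splits)
    then show ?thesis
      unfolding 2(2) using lit_color_lt by (auto simp: clause_group_def)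
  qed
qed

lemma sat_groups_cases:
  assumes "G \<in> set (sat_groups d n \<phi>)"
  obtains V where "V \<in> set (var_groups d n)" "G = var_group \<gamma> V"
    | J where "J \<in> set (clause_groups d \<phi>)" "G = clause_group \<gamma> \<phi> J"
  using assms by (auto simp: sat_groups_def)

section \<open>Satisfying assignments and transversals\<close>

lemma clause_group_block:
  assumes "J \<in> set (clause_groups d \<phi>)"
  shows "b \<in> set (blocks (clause_group \<gamma> \<phi> J)) \<longleftrightarrow> (\<exists>i\<in>set J. b = map (lit_color \<gamma>) (\<phi> ! i))"
  using clause_group_props(4)[OF assms] by (fastforce simp: clause_group_def nth_default_def)

lemma block_inter_unique:
  assumes "distinct (concat B)" "b \<in> set B" "c \<in> set B" "x \<in> set b" "x \<in> set c"
  shows "b = c"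
  using assms unfolding distinct_concat_iff by blast

lemma group_solution_if_satisfiable:
  assumes "satisfiable \<phi>"
  shows "\<exists>U. group_solution (sat_groups d n \<phi>) U"
proof -
  from assms obtain \<sigma> where \<sigma>: "\<forall>C\<in>set \<phi>. \<exists>(x, s)\<in>set C. \<sigma> x = s"
    unfolding satisfiable_def by blast
  \<comment> \<open>\<open>T\<close> and \<open>F\<close> hold the colors of the true and of the
    false literals over the variables of a group.\<close>
  define T where "T G = {lit_color \<gamma> (x, \<sigma> x) | x. x \<in> set (vars G)}" for G :: group
  define F where "F G = {lit_color \<gamma> (x, \<not> \<sigma> x) | x. x \<in> set (vars G)}" for G :: group
  define pick where "pick G b = (SOME c. c \<in> set b \<inter> T G)" for G b
  define U where "U G = (if kind G = 0 then F G else pick G ` set (blocks G))" for G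
  have pick: "pick G b \<in> set b \<inter> T G" if J: "J \<in> set (clause_groups d \<phi>)"
    and G: "G = clause_group \<gamma> \<phi> J" and b: "b \<in> set (blocks G)" for G J b
  proof -
    from b obtain i where i: "i \<in> set J" "b = map (lit_color \<gamma>) (\<phi> ! i)"
      unfolding G clause_group_block[OF J] by blast
    then have "i < length \<phi>" using clause_group_props(4)[OF J] by auto
    then obtain x s where xs: "(x, s) \<in> set (\<phi> ! i)" "\<sigma> x = s" using \<sigma> nth_mem by blast
    then have "x \<in> set (group_vars \<phi> J)"
      using i(1) \<open>i < length \<phi>\<close> unfolding in_group_vars[OF J] occ_def by force
    then have "lit_color \<gamma> (x, s) \<in> set b \<inter> T G"
      using xs i(2) unfolding T_def by (auto simp: G clause_group_def)
    then show ?thesis unfolding pick_def by (rule someI)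
  qed
  have "group_solution (sat_groups d n \<phi>) U"
    unfolding group_solution_def
  proof (intro conjI ballI impI)
    fix G assume "G \<in> set (sat_groups d n \<phi>)"
    then show "transversal (U G) (blocks G)"
    proof (cases rule: sat_groups_cases)
      case (1 V)
      have dist: "distinct (concat (blocks G))"
        using block_system_var_group[OF 1(1)] unfolding 1(2) block_system_def by blast
      have UG: "U G = {lit_color \<gamma> (x, \<not> \<sigma> x) | x. x \<in> set V}"
        unfolding 1(2) by (simp add: U_def F_def var_group_def)
      have B: "set (blocks G) = (\<lambda>x. [lit_color \<gamma> (x, False), lit_color \<gamma> (x, True)]) ` set V"
        unfolding 1(2) by (auto simp: var_group_def)
      have in_block: "lit_color \<gamma> (x, s) \<in> set [lit_color \<gamma> (x, False), lit_color \<gamma> (x, True)]" for x s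
        by (cases s) auto
      \<comment> \<open>A second pick in the block would belong to some \<open>y\<close> in the same
        group. Disjointness makes the blocks of \<open>x\<close> and \<open>y\<close> coincide, and
        conflicting variables with one color are equal.\<close>
      have "U G \<inter> set b = {lit_color \<gamma> (x, \<not> \<sigma> x)}"
        if x: "x \<in> set V" "b = [lit_color \<gamma> (x, False), lit_color \<gamma> (x, True)]" for x b
      proof
        show "{lit_color \<gamma> (x, \<not> \<sigma> x)} \<subseteq> U G \<inter> set b"
          using x in_block unfolding UG by blast
        show "U G \<inter> set b \<subseteq> {lit_color \<gamma> (x, \<not> \<sigma> x)}"
        proof
          fix c assume c: "c \<in> U G \<inter> set b"
          then obtain y where y: "y \<in> set V" "c = lit_color \<gamma> (y, \<not> \<sigma> y)" unfolding UG by blast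
          let ?b = "[lit_color \<gamma> (y, False), lit_color \<gamma> (y, True)]"
          have "?b = b"
            by (rule block_inter_unique[OF dist, of _ _ c]) (use x y c in_block B in blast)+
          then have "nth_default 0 \<gamma> x = nth_default 0 \<gamma> y"
            unfolding x(2) by (simp add: lit_color_eq)
          then have "x = y"
            using var_colors_inj confl_var_group[OF 1(1)] x(1) y(1) var_group_props(4)[OF 1(1)] by blast
          then show "c \<in> {lit_color \<gamma> (x, \<not> \<sigma> x)}" using y by simp
        qed
      qed
      then have "\<forall>b\<in>set (blocks G). card (U G \<inter> set b) = 1"
        unfolding B by auto
      moreover have "U G \<subseteq> set (concat (blocks G))"
        unfolding set_concat B UG using in_block by fastforce
      ultimately show ?thesis unfolding transversal_def by blast
    next
      case (2 J)
      have dist: "distinct (concat (blocks G))"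
        using block_system_clause_group[OF 2(1)] unfolding 2(2) block_system_def by blast
      have UG: "U G = pick G ` set (blocks G)"
        unfolding 2(2) by (simp add: U_def clause_group_def)
      have in_block: "pick G b \<in> set b" if "b \<in> set (blocks G)" for b
        using pick[OF 2 that] by blast
      have "U G \<inter> set b = {pick G b}" if b: "b \<in> set (blocks G)" for b
        using block_inter_unique[OF dist _ b] in_block b unfolding UG by blast
      moreover have "U G \<subseteq> set (concat (blocks G))"
        unfolding set_concat UG using in_block by blast
      ultimately show ?thesis unfolding transversal_def by simp
    qed
  next
    fix G H
    assume GH: "G \<in> set (sat_groups d n \<phi>)" "H \<in> set (sat_groups d n \<phi>)" "kind G = 0" "kind H = 1"
      "set (vars G) \<inter> set (vars H) \<noteq> {}"
    obtain V where V: "V \<in> set (var_groups d n)" "G = var_group \<gamma> V"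
      using GH(1,3) by (cases rule: sat_groups_cases) (auto simp: clause_group_def)
    obtain J where J: "J \<in> set (clause_groups d \<phi>)" "H = clause_group \<gamma> \<phi> J"
      using GH(2,4) by (cases rule: sat_groups_cases) (auto simp: var_group_def)
    have meet: "set V \<inter> set (group_vars \<phi> J) \<noteq> {}"
      using GH(5) unfolding V(2) J(2) by (simp add: var_group_def clause_group_def)
    have "U G = F G" "U H \<subseteq> T H"
      using GH(3,4) pick[OF J] by (auto simp: U_def)
    \<comment> \<open>A common color would come from two conflicting variables, hence from a single
      variable, whose literal would be both true and false.\<close>
    moreover have "F G \<inter> T H = {}"
    proof -
      have False if "x \<in> set V" "y \<in> set (group_vars \<phi> J)"
        "lit_color \<gamma> (x, \<not> \<sigma> x) = lit_color \<gamma> (y, \<sigma> y)" for x y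
      proof -
        have "x < n" "y < n"
          using that(1,2) var_group_props(4)[OF V(1)] group_vars_lt[OF J(1)] by auto
        then have "x = y"
          using var_colors_inj[OF _ _ confl_clause_var[OF J(1) V(1) meet that(1,2)]] that(3)
          by (simp add: lit_color_eq)
        then show False using that(3) by (simp add: lit_color_eq)
      qed
      then show ?thesis
        unfolding F_def T_def V(2) J(2) by (auto simp: var_group_def clause_group_def)
    qed
    ultimately show "U G \<inter> U H = {}" by blast
  qed
  then show ?thesis by blast
qed

lemma satisfiable_if_group_solution:
  assumes "group_solution (sat_groups d n \<phi>) U"
  shows "satisfiable \<phi>"
proof -
  have "\<exists>V. V \<in> set (var_groups d n) \<and> x \<in> set V" if "x < n" for x
    using var_group_exists[OF that] by blast
  then obtain V where V: "\<And>x. x < n \<Longrightarrow> V x \<in> set (var_groups d n) \<and> x \<in> set (V x)"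
    by metis
  define X where "X x = U (var_group \<gamma> (V x))" for x
  have VG: "var_group \<gamma> (V x) \<in> set (sat_groups d n \<phi>)" if "x < n" for x
    using V[OF that] by (simp add: sat_groups_def)
  \<comment> \<open>Variable selectors pick false literals, so \<open>x\<close> is true if its
    positive literal is left out.\<close>
  define \<sigma> where "\<sigma> x \<longleftrightarrow> lit_color \<gamma> (x, True) \<notin> X x" for x
  \<comment> \<open>Exactly one of the two literals of \<open>x\<close> is picked; if one is left
    out, the other is the false one.\<close>
  have true: "\<sigma> x = s" if "x < n" "lit_color \<gamma> (x, s) \<notin> X x" for x s
  proof (cases s)
    case False
    have "transversal (X x) (blocks (var_group \<gamma> (V x)))"
      using assms VG[OF that(1)] unfolding group_solution_def X_def by blast
    then have "card (X x \<inter> {lit_color \<gamma> (x, False), lit_color \<gamma> (x, True)}) = 1"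
      using V[OF that(1)] unfolding transversal_def by (auto simp: var_group_def)
    then have "lit_color \<gamma> (x, True) \<in> X x"
      using that(2) False by (cases "lit_color \<gamma> (x, True) \<in> X x") auto
    then show ?thesis using False by (simp add: \<sigma>_def)
  qed (use that in \<open>simp add: \<sigma>_def\<close>)
  have "\<exists>(x, s)\<in>set (\<phi> ! i). \<sigma> x = s" if i: "i < length \<phi>" for i
  proof -
    from clause_group_exists[OF i] obtain J where J: "J \<in> set (clause_groups d \<phi>)" "i \<in> set J"
      by blast
    let ?H = "clause_group \<gamma> \<phi> J"
    have H: "?H \<in> set (sat_groups d n \<phi>)" using J by (simp add: sat_groups_def)
    have "map (lit_color \<gamma>) (\<phi> ! i) \<in> set (blocks ?H)"
      using J(2) unfolding clause_group_block[OF J(1)] by blast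
    then have "card (U ?H \<inter> set (map (lit_color \<gamma>) (\<phi> ! i))) = 1"
      using assms H unfolding group_solution_def transversal_def by blast
    then obtain l where l: "l \<in> set (\<phi> ! i)" "lit_color \<gamma> l \<in> U ?H"
      by (metis (no_types, lifting) card.empty disjoint_iff imageE list.set_map zero_neq_one)
    have "fst l < n" using clause_props(3)[OF i] l(1) by auto
    have "fst l \<in> set (group_vars \<phi> J)"
      using i l(1) J(2) unfolding in_group_vars[OF J(1)] occ_def by blast
    then have "set (vars (var_group \<gamma> (V (fst l)))) \<inter> set (vars ?H) \<noteq> {}"
      using V[OF \<open>fst l < n\<close>] by (auto simp: var_group_def clause_group_def)
    \<comment> \<open>The two groups share the variable of \<open>l\<close>, so their transversals
      are disjoint and the color of \<open>l\<close> is left out by the variable group.\<close>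
    then have "X (fst l) \<inter> U ?H = {}"
      using assms VG[OF \<open>fst l < n\<close>] H unfolding group_solution_def X_def
      by (simp add: var_group_def clause_group_def)
    then have "\<sigma> (fst l) = snd l"
      using true[OF \<open>fst l < n\<close>, of "snd l"] l(2) by auto
    then show ?thesis using l(1) by (auto simp: case_prod_beta)
  qed
  then show ?thesis
    unfolding satisfiable_def by (intro exI[of _ \<sigma>]) (simp add: all_set_conv_all_nth)
qed

lemma length_sat_groups: "d * length (sat_groups d n \<phi>) \<le> 5 * n + 14 * d"
  using length_var_groups length_clause_groups by (simp add: sat_groups_def algebra_simps)

end

section \<open>Running time of the construction\<close>

lemma ptime_comp2:
  assumes "ptime (\<lambda>z. g (fst z) (snd z))" "ptime a" "ptime b"
  shows "ptime (\<lambda>i. g (a i) (b i))"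
  using ptime_comp[OF assms(1) ptime_Pair[OF assms(2,3)]] by simp

lemma ptime_comp3:
  assumes "ptime (\<lambda>z. g (fst z) (fst (snd z)) (snd (snd z)))" "ptime a" "ptime b" "ptime c"
  shows "ptime (\<lambda>i. g (a i) (b i) (c i))"
  using ptime_comp[OF assms(1) ptime_Pair[OF assms(2) ptime_Pair[OF assms(3,4)]]] by simp

lemma ptime_member [ptime_intros]:
  assumes "ptime x" "ptime xs"
  shows "ptime (\<lambda>i. (x i :: nat) \<in> set (xs i))"
proof (rule ptime_comp2[OF _ assms])
  have "ptime (\<lambda>z. \<exists>y\<in>set (snd z). fst z = (y :: nat))"
    by (intro ptime_intros)
  then show "ptime (\<lambda>z. fst z \<in> set (snd z :: nat list))" by simp
qed

lemma ptime_mex [ptime_intros]: "ptime U \<Longrightarrow> ptime (\<lambda>i. mex (U i))"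
proof (rule ptime_comp[of mex])
  show "ptime mex" unfolding mex_def by (intro ptime_intros)
qed

text \<open>A greedy color never exceeds the number of earlier vertices, so partial colorings have
  quadratic size even with unary numbers.\<close>

lemma ptime_greedy [ptime_intros]:
  assumes adj: "ptime (\<lambda>z. adj (fst z) (fst (snd z)) (snd (snd z)))" and n: "ptime n"
  shows "ptime (\<lambda>i. greedy (adj i) (n i))"
  unfolding greedy_def
proof (rule ptime_foldl[where B = "\<lambda>i. esize (n i) * (esize (n i) + 1)"])
  fix i k
  assume "k \<le> length [0..<n i]"
  then have k: "k \<le> n i" by simp
  let ?cs = "greedy (adj i) k"
  have "c \<le> n i" if "c \<in> set ?cs" for c
  proof -
    from that obtain v where v: "v < k" "c = ?cs ! v" by (auto simp: in_set_conv_nth)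
    then have "c \<le> card {u. u < v \<and> adj i v u}" by (simp add: greedy_le_card)
    also have "\<dots> \<le> card {..<v}" by (intro card_mono) auto
    finally show ?thesis using v(1) k by simp
  qed
  then have "esize ?cs \<le> n i * (n i + 1)"
    by (intro esize_list_le) (simp_all add: k)
  then show "esize (foldl (\<lambda>cs v. cs @ [mex (map (nth_default 0 cs)
      (filter (adj i v) [0..<length cs]))]) [] (take k [0..<n i])) \<le> esize (n i) * (esize (n i) + 1)"
    using k by (simp add: greedy_def)
qed (intro ptime_intros poly_bounded_intros n ptime_comp3[OF adj])+

lemma ptime_chunks [ptime_intros]: "ptime d \<Longrightarrow> ptime xs \<Longrightarrow> ptime (\<lambda>i. chunks (d i) (xs i))"
proof (rule ptime_comp2[of chunks])
  show "ptime (\<lambda>z. chunks (fst z) (snd z :: 'b list))"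
    unfolding chunks_def by (intro ptime_intros)
qed

text \<open>The number of rows, their lengths and their entries are all at most
  \<open>b + 1\<close>. This bounds the state of the fold in \<open>family\<close>.\<close>

lemma good_family_esize:
  assumes "good_family b s"
  shows "esize s \<le> (b + 1) + (b + 1) * ((b + 1) * (b + 2) + 1) + 1"
proof -
  obtain d rows where s: "s = (d, rows)" by (cases s)
  from assms have rb: "rows_below d rows" and d: "d \<le> b + 1"
    unfolding good_family_def s by auto
  from assms obtain k where "length rows = 4 ^ k" "4 * d = 4 ^ k * (k + 4)"
    unfolding good_family_def s by auto
  then have "length rows \<le> d" by (simp add: algebra_simps)
  moreover have "esize S \<le> (b + 1) * (b + 2)" if "S \<in> set rows" for S
    using esize_list_le[of S "b + 1" "b + 1"] length_le_of_rows_below[OF rb that] rb that d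
    unfolding rows_below_def by fastforce
  ultimately have "esize rows \<le> (b + 1) * ((b + 1) * (b + 2) + 1)"
    using d by (intro esize_list_le) auto
  then show ?thesis using d unfolding s by simp
qed

lemma ptime_grow [ptime_intros]: "ptime b \<Longrightarrow> ptime s \<Longrightarrow> ptime (\<lambda>i. grow (b i) (s i))"
proof (rule ptime_comp2[of grow])
  show "ptime (\<lambda>z. grow (fst z) (snd z))"
    unfolding grow_def refine_def quad_def shifted_def by (intro ptime_intros)
qed

lemma ptime_family [ptime_intros]: "ptime b \<Longrightarrow> ptime (\<lambda>i. family (b i))"
proof (rule ptime_comp[of family])
  show "ptime family"
    unfolding family_def
  proof (rule ptime_foldl[where B = "\<lambda>b. (esize b + 1) + (esize b + 1) * ((esize b + 1) * (esize b + 2) + 1) + 1"])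
    show "esize (foldl (\<lambda>s _. grow b s) (1, [[0]]) (take k [0..<b]))
      \<le> (esize b + 1) + (esize b + 1) * ((esize b + 1) * (esize b + 2) + 1) + 1" for b k
      using good_family_esize[OF good_family_foldl[of b]] by simp
  qed (intro ptime_intros poly_bounded_intros)+
qed

lemma ptime_vertices [ptime_intros]: "ptime rows \<Longrightarrow> ptime GS \<Longrightarrow> ptime (\<lambda>i. vertices (rows i) (GS i))"
proof (rule ptime_comp2[of vertices])
  show "ptime (\<lambda>z. vertices (fst z) (snd z))"
    unfolding vertices_def gadget_def selector_def tester_def tests_def block_union_def Let_def
    by (intro ptime_intros)
qed

lemma ptime_edge_list [ptime_intros]: "ptime W \<Longrightarrow> ptime (\<lambda>i. edge_list (W i))"
proof (rule ptime_comp[of edge_list])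
  show "ptime edge_list"
    unfolding edge_list_def adjacent_def vertex_at_def by (intro ptime_intros)
qed

lemma ptime_sat_groups [ptime_intros]:
  assumes "ptime d" "ptime n" "ptime \<phi>"
  shows "ptime (\<lambda>i. sat_groups (d i) (n i) (\<phi> i))"
proof (rule ptime_comp3[OF _ assms])
  show "ptime (\<lambda>z. sat_groups (fst z) (fst (snd z)) (snd (snd z)))"
    unfolding sat_groups_def var_group_def clause_group_def var_groups_def clause_groups_def
      clause_classes_def share_def var_colors_def conflict_def group_vars_def group_lits_def
      lit_color_def
    by (intro ptime_intros)
qed

section \<open>The reduction as a program\<close>

text \<open>Total on triples that encode no instance, because \<open>ptime\<close> covers all
  inputs; correctness is claimed for instances only.\<close>

definition reduction ::
    "nat \<times> cnf \<times> nat \<Rightarrow>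
       nat \<times> (nat \<times> nat) list \<times> nat list list \<times> nat list \<times> nat list" where
  "reduction z =
     (let F = family (snd (snd z));
          W = vertices (snd F) (sat_groups (fst F) (fst z) (fst (snd z)))
      in (length W, edge_list W, map vlist W, map vdemand W, map vkind W))"

lemma ptime_reduction: "ptime reduction"
  unfolding reduction_def Let_def by (intro ptime_intros)

lemma ptime_computes:
  assumes "ptime f"
  obtains P p where "\<And>x. \<exists>t. computes P (enc x) (enc (f x)) t \<and> t \<le> poly p (esize x)"
proof -
  from assms obtain P e T where T: "poly_bounded T" and run: "runs P e f T"
    and size: "poly_bounded (\<lambda>x. esize (f x))"
    unfolding ptime_def by blast
  from T obtain p where p: "\<And>x. T x \<le> poly p (esize x)" unfolding poly_bounded_def by blast
  from size obtain q where q: "\<And>x. esize (f x) \<le> poly q (esize x)" unfolding poly_bounded_def by blast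
  \<comment> \<open>\<open>computes\<close> starts at function 0, so the entry expression is put in
    front and all call indices move up by one. The summand \<open>q\<close> in the bound pays for
    writing out the result.\<close>
  let ?P = "shift 1 e # map (shift 1) P"
  have "\<exists>t. computes ?P (enc x) (enc (f x)) t \<and> t \<le> poly (p + q) (esize x)" for x
  proof -
    from run obtain s where s: "s \<le> T x" "eval P [enc x] e (enc (f x)) s"
      unfolding runs_def by blast
    from eval_program_shift(1)[OF s(2), of "[shift 1 e]"]
    have "eval ?P [enc x] (?P ! 0) (enc (f x)) s" by simp
    then have "computes ?P (enc x) (enc (f x)) (s + esize (f x))"
      unfolding computes_def by blast
    moreover have "s + esize (f x) \<le> poly (p + q) (esize x)"
      using order_trans[OF s(1) p] q by (simp add: add_mono)
    ultimately show ?thesis by blast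
  qed
  then show thesis by (rule that)
qed

lemma enc_sat34_eq: "enc_sat34 n \<phi> b = enc (n, \<phi>, b)"
  by (simp add: enc_sat34_def enc_nat_inst enc_bool_inst enc_list_inst enc_prod_inst)

text \<open>Literals have size at most \<open>n + 2\<close> and clauses at most
  \<open>3 * (n + 3)\<close>, and there are at most \<open>4 * n\<close> clauses. The numbers
  \<open>n\<close> and \<open>b\<close> and two pair nodes add \<open>2 * n + 2\<close>.\<close>

lemma esize_sat34_le:
  assumes inst: "sat34_instance n \<phi>" and "b \<le> n"
  shows "esize (n, \<phi>, b) \<le> poly [:2, 42, 12:] n"
proof -
  have "esize C \<le> 3 * (n + 3)" if C: "C \<in> set \<phi>" for C
  proof (rule order_trans[OF esize_list_le[of C 3 "n + 2"]])
    show "length C \<le> 3" using inst C unfolding sat34_instance_def by simp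
    fix l assume l: "l \<in> set C"
    have "fst l < n" using inst C l unfolding sat34_instance_def clause_vars_def by blast
    then show "esize l \<le> n + 2"
      using esize_bool_le[of "snd l"] by (cases l) auto
  qed simp
  then have "esize \<phi> \<le> 4 * n * (3 * (n + 3) + 1)"
    using length_le_vars[OF inst] by (intro esize_list_le) auto
  then show ?thesis
    using assms(2) by (simp add: algebra_simps)
qed

theorem theorem9:
  "\<exists>(c\<^sub>a :: real) (c\<^sub>V :: real) (P :: program) (p :: nat poly).
     \<forall>(n :: nat) (\<phi> :: cnf) (b :: nat).
       sat34_instance n \<phi> \<longrightarrow> 2 \<le> b \<longrightarrow> real b \<le> real n / log 2 (real n) \<longrightarrow>
       (\<exists>(a :: nat) (G :: nat graph) (L :: nat \<Rightarrow> nat set) (\<beta> :: nat \<Rightarrow> nat) (c :: nat \<Rightarrow> nat).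
          nonuniform_instance a (2 * b) G L \<beta> \<and>
          (satisfiable \<phi> \<longleftrightarrow> list_multicolorable G L \<beta>) \<and>
          real a \<le> c\<^sub>a * (real b ^ 2 * log 2 (real b)) \<and>
          real (card (verts G)) \<le> c\<^sub>V * (real n / log 2 (real b)) \<and>
          colorable G 3 \<and>
          proper_coloring G 3 c \<and>
          (\<exists>y t. computes P (enc_sat34 n \<phi> b) y t \<and> t \<le> poly p n \<and>
                 encodes_colored_instance y G L \<beta> c))"
proof -
  obtain P p where Pp: "\<And>x. \<exists>t. computes P (enc x) (enc (reduction x)) t \<and> t \<le> poly p (esize x)"
    using ptime_computes[OF ptime_reduction] by blast
  \<comment> \<open>52 comes from \<open>lit_color_lt\<close>, and 684 is the product of 19, 3 and
    12 in the vertex count below. Composition with the quadratic polynomial turns a bound in the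
    input size into one in \<open>n\<close>.\<close>
  show ?thesis
  proof (rule exI[of _ 52], rule exI[of _ 684], rule exI[of _ P],
      rule exI[of _ "pcompose p [:2, 42, 12:]"], intro allI impI)
    fix n b :: nat and \<phi> :: cnf
    assume inst: "sat34_instance n \<phi>" and b2: "2 \<le> b" and bn: "real b \<le> real n / log 2 (real n)"
    \<comment> \<open>For \<open>n \<le> 1\<close> the quotient \<open>n / log 2 n\<close> is 0, as
      division by 0 yields 0, and no \<open>b\<close> with \<open>2 \<le> b\<close> is below
      it.\<close>
    have "n \<ge> 2"
    proof (rule ccontr)
      assume "\<not> n \<ge> 2"
      then have "n = 0 \<or> n = 1" by auto
      then show False using b2 bn by auto
    qed
    then have "1 \<le> log 2 (real n)" by simp
    then have "real n / log 2 (real n) \<le> real n" by (simp add: divide_le_eq mult_le_cancel_left1)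
    with bn have "b \<le> n" by linarith
    have logb: "1 \<le> log 2 (real b)" using b2 by simp
    define d where "d = fst (family b)"
    define rows where "rows = snd (family b)"
    define GS where "GS = sat_groups d n \<phi>"
    define W where "W = vertices rows GS"
    from good_family[of b] b2 have rows: "rows_below d rows" "detecting d rows" and d: "1 \<le> d" "d \<le> b"
      and r: "1 \<le> length rows"
      unfolding good_family_def d_def rows_def by auto
    have GS: "group_instance d GS"
      unfolding GS_def by (rule group_instance_sat_groups[OF inst d(1)])
    let ?G = "gadget_graph W" and ?L = "\<lambda>p. set (vlist (vertex_at W p))"
      and ?\<beta> = "\<lambda>p. vdemand (vertex_at W p)" and ?c = "\<lambda>p. vkind (vertex_at W p)"
    have 1: "nonuniform_instance (52 * d\<^sup>2) (2 * b) ?G ?L ?\<beta>"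
      unfolding nonuniform_instance_def
    proof (intro conjI ballI simple_gadget_graph)
      fix p assume "p \<in> verts ?G"
      then have "vertex_at W p \<in> set (vertices rows GS)" by (simp add: vertex_at_nth W_def)
      note * = vertices_bounds[OF rows(1) GS this]
      show "?L p \<subseteq> {..<52 * d\<^sup>2}"
        using *(4) sat_groups_colors[OF inst d(1)] unfolding GS_def by blast
      show "?\<beta> p \<in> {1..2 * b}"
        using *(2,3) d(2) by simp
    qed
    have 2: "satisfiable \<phi> \<longleftrightarrow> list_multicolorable ?G ?L ?\<beta>"
      using multicolorable_if_group_solution[OF rows(1) GS _ W_def]
        group_solution_if_multicolorable[OF rows GS W_def]
        group_solution_if_satisfiable[OF inst d(1)] satisfiable_if_group_solution[OF inst d(1)]
      unfolding GS_def by blast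
    \<comment> \<open>Since \<open>b \<ge> 2\<close>, the logarithm is at least 1, so a bound of 52
      b^2 is enough.\<close>
    have "real (52 * d\<^sup>2) \<le> 52 * (real b ^ 2 * 1)"
      using d(2) by (simp add: power_mono)
    also have "\<dots> \<le> 52 * (real b ^ 2 * log 2 (real b))"
      using logb by (intro mult_left_mono) auto
    finally have 3: "real (52 * d\<^sup>2) \<le> 52 * (real b ^ 2 * log 2 (real b))" .
    have 4: "real (card (verts ?G)) \<le> 684 * (real n / log 2 (real b))"
    proof -
      \<comment> \<open>Everything is multiplied by \<open>d\<close> to stay free of divisions. In
        \<open>5 * n + 14 * d\<close> the bounds \<open>d \<le> b\<close> and
        \<open>b \<le> n\<close> give 19, and \<open>1 + 2 * length rows\<close> is at most
        \<open>3 * length rows\<close>.\<close>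
      have "d * length W \<le> (d * length GS) * (1 + 2 * length rows)"
        unfolding W_def mult.assoc by (rule mult_left_mono[OF length_vertices_le]) simp
      also have "\<dots> \<le> (19 * n) * (3 * length rows)"
      proof (rule mult_mono)
        show "d * length GS \<le> 19 * n"
          using length_sat_groups[OF inst d(1)] d(2) \<open>b \<le> n\<close> unfolding GS_def by linarith
      qed (use r in auto)
      finally have "real (d * length W) \<le> real ((19 * n) * (3 * length rows))"
        by (simp only: of_nat_le_iff)
      then have "real d * real (length W) * log 2 (real b) \<le> 57 * real n * real (length rows) * log 2 (real b)"
        using logb by (intro mult_right_mono) auto
      also have "\<dots> = 57 * real n * (real (length rows) * log 2 (real b))" by simp
      also have "\<dots> \<le> 57 * real n * (12 * real d)"
        using family_ratio[of b] b2 unfolding d_def rows_def by (intro mult_left_mono) auto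
      finally have "real d * (real (length W) * log 2 (real b)) \<le> real d * (684 * real n)"
        by (simp add: mult_ac)
      then have "real (length W) * log 2 (real b) \<le> 684 * real n"
        using d(1) by simp
      then show ?thesis
        using logb by (simp add: pos_le_divide_eq)
    qed
    have 5: "proper_coloring ?G 3 ?c"
      using vertices_bounds(1)[OF rows(1) GS] gadget_graph_coloring[of W] unfolding W_def by blast
    have 6: "encodes_colored_instance (enc (reduction (n, \<phi>, b))) ?G ?L ?\<beta> ?c"
    proof -
      have map: "map (\<lambda>p. f (vertex_at W p)) [0..<length W] = map f W" for f :: "vertex \<Rightarrow> nat"
        by (rule nth_equalityI) (auto simp: vertex_at_nth)
      have "reduction (n, \<phi>, b) = (length W, edge_list W, map vlist W, map vdemand W, map vkind W)"
        by (simp add: reduction_def W_def GS_def d_def rows_def Let_def)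
      then show ?thesis
        unfolding encodes_colored_instance_def
        by (intro exI[of _ "length W"] exI[of _ "edge_list W"] exI[of _ "map vlist W"])
          (auto simp: map[of vdemand] map[of vkind] vertex_at_nth gadget_graph_def enc_nat_inst enc_list_inst enc_prod_inst)
    qed
    from Pp[of "(n, \<phi>, b)"] obtain t where
      t: "computes P (enc_sat34 n \<phi> b) (enc (reduction (n, \<phi>, b))) t" "t \<le> poly p (esize (n, \<phi>, b))"
      unfolding enc_sat34_eq by blast
    have "t \<le> poly (pcompose p [:2, 42, 12:]) n"
      using order_trans[OF t(2) poly_nat_mono[OF esize_sat34_le[OF inst \<open>b \<le> n\<close>]]]
      by (simp only: poly_pcompose)
    with t(1) 1 2 3 4 5 6 show "\<exists>a G L \<beta> c.
          nonuniform_instance a (2 * b) G L \<beta> \<and>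
          (satisfiable \<phi> \<longleftrightarrow> list_multicolorable G L \<beta>) \<and>
          real a \<le> 52 * (real b ^ 2 * log 2 (real b)) \<and>
          real (card (verts G)) \<le> 684 * (real n / log 2 (real b)) \<and>
          colorable G 3 \<and> proper_coloring G 3 c \<and>
          (\<exists>y t. computes P (enc_sat34 n \<phi> b) y t \<and> t \<le> poly (pcompose p [:2, 42, 12:]) n \<and>
             encodes_colored_instance y G L \<beta> c)"
      unfolding colorable_def by blast
  qed
qed

end
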